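(* Let $d \in \mathbb{N}$ and let $f:[-1,1]\times\mathbb{R}\to\mathbb{R}$ be continuously differentiable in its first argument. If $f \in \mathcal{P}(\mathbb{S}^d\times\mathbb{R})$, then $\frac{\partial}{\partial x} f(x,t) \in \mathcal{P}(\mathbb{S}^{d+2}\times\mathbb{R})$.
   Context: $\mathbb{S}^d$ is the unit sphere in $\mathbb{R}^{d+1}$, with geodesic distance $d(\xi,\eta)=\arccos\langle \xi,\eta\rangle$. For $d \in \mathbb{N}=\{1,2,\dots\}$, $\mathcal{P}(\mathbb{S}^d\times\mathbb{R})$ denotes the class of continuous functions $f:[-1,1]\times\mathbb{R}\to\mathbb{R}$ such that the kernel $((\xi,s),(\eta,t)) \mapsto f(\cos d(\xi,\eta),\, s-t)$ is positive definite on $\mathbb{S}^d\times\mathbb{R}$, i.e. $\sum_{i,j} c_i \overline{c_j} f(\langle \xi_i,\xi_j\rangle, t_i-t_j)\ge 0$ for all finite families of points $(\xi_i,t_i)\in\mathbb{S}^d\times\mathbb{R}$ and scalars $c_i \in \mathbb{C}$. "Continuously differentiable in its first argument" means that $\partial f(x,t)/\partial x$ exists (one-sided at $x=\pm1$) and is continuous on $[-1,1]\times\mathbb{R}$. *)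

theory Defs
  imports "HOL-Analysis.Analysis"
begin

text \<open>
  Points of the sphere of dimension \<open>d\<close> are the elements of \<^term>\<open>topspace (nsphere d)\<close>: functions
  on the naturals, vanishing at all indices greater than \<open>d\<close>, whose coordinates \<open>0, \<dots>, d\<close>
  have square sum 1.
\<close>

abbreviation unit_sphere :: "nat \<Rightarrow> (nat \<Rightarrow> real) set"
  where "unit_sphere d \<equiv> topspace (nsphere d)"

definition sphere_inner :: "nat \<Rightarrow> (nat \<Rightarrow> real) \<Rightarrow> (nat \<Rightarrow> real) \<Rightarrow> real"
  where "sphere_inner d \<xi> \<eta> = (\<Sum>i\<le>d. \<xi> i * \<eta> i)"

definition geodesic_dist :: "nat \<Rightarrow> (nat \<Rightarrow> real) \<Rightarrow> (nat \<Rightarrow> real) \<Rightarrow> real"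
  where "geodesic_dist d \<xi> \<eta> = arccos (sphere_inner d \<xi> \<eta>)"

text \<open>
  Finite families are indexed by \<open>i < n\<close>, and repeated points are allowed. Membership in
  \<open>\<real>\<^sub>\<ge>\<^sub>0\<close> says that the complex number is real and nonnegative.
\<close>

definition positive_definite_kernel :: "'a set \<Rightarrow> ('a \<Rightarrow> 'a \<Rightarrow> real) \<Rightarrow> bool"
  where "positive_definite_kernel X K \<longleftrightarrow>
    (\<forall>(n::nat) (p :: nat \<Rightarrow> 'a) (c :: nat \<Rightarrow> complex).
      (\<forall>i<n. p i \<in> X) \<longrightarrow>
      (\<Sum>i<n. \<Sum>j<n. c i * cnj (c j) * complex_of_real (K (p i) (p j))) \<in> \<real>\<^sub>\<ge>\<^sub>0)"

text \<open>
  A function on \<open>[-1,1] \<times> \<real>\<close> is represented by a total function on pairs. Membership in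
  \<open>pd_sphere_line d\<close> depends only on its restriction to \<open>{-1..1} \<times> UNIV\<close>.
\<close>

definition pd_sphere_line :: "nat \<Rightarrow> (real \<times> real \<Rightarrow> real) set"
  where "pd_sphere_line d =
    {f. continuous_on ({-1..1} \<times> UNIV) f \<and>
        positive_definite_kernel (unit_sphere d \<times> (UNIV :: real set))
          (\<lambda>(\<xi>, s) (\<eta>, t). f (cos (geodesic_dist d \<xi> \<eta>), s - t))}"

text \<open>The filter \<open>at x within {-1..1}\<close> makes the derivative one-sided at \<open>x = -1\<close> and \<open>x = 1\<close>.\<close>

definition partial_fst :: "(real \<times> real \<Rightarrow> real) \<Rightarrow> real \<times> real \<Rightarrow> real"
  where "partial_fst f = (\<lambda>(x, t). vector_derivative (\<lambda>u. f (u, t)) (at x within {-1..1}))"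

definition continuously_differentiable_fst :: "(real \<times> real \<Rightarrow> real) \<Rightarrow> bool"
  where "continuously_differentiable_fst f \<longleftrightarrow>
    (\<forall>x\<in>{-1..1}. \<forall>t. (\<lambda>u. f (u, t)) differentiable (at x within {-1..1})) \<and>
    continuous_on ({-1..1} \<times> UNIV) (partial_fst f)"

lemma cos_geodesic_dist:
  assumes "\<xi> \<in> unit_sphere d" "\<eta> \<in> unit_sphere d"
  shows "cos (geodesic_dist d \<xi> \<eta>) = sphere_inner d \<xi> \<eta>"
proof -
  have "(\<Sum>i\<le>d. (\<xi> i)\<^sup>2) = 1" "(\<Sum>i\<le>d. (\<eta> i)\<^sup>2) = 1"
    using assms by (simp_all add: nsphere)
  then have "(sphere_inner d \<xi> \<eta>)\<^sup>2 \<le> 1"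
    using Cauchy_Schwarz_ineq_sum[of \<xi> \<eta> "{..d}"] by (simp add: sphere_inner_def)
  then have "\<bar>sphere_inner d \<xi> \<eta>\<bar> \<le> 1"
    by (simp add: abs_square_le_1)
  then show ?thesis
    by (simp add: geodesic_dist_def cos_arccos_abs)
qed

lemma has_real_derivative_partial_fst:
  assumes "continuously_differentiable_fst f" "x \<in> {-1..1}"
  shows "((\<lambda>u. f (u, t)) has_real_derivative partial_fst f (x, t)) (at x within {-1..1})"
  using assms
  by (auto simp: continuously_differentiable_fst_def partial_fst_def
      has_real_derivative_iff_has_vector_derivative vector_derivative_works)

end

theory Submission
  imports Defs "HOL-Probability.Probability"
begin

text \<open>
  Write \<open>d = e + 1\<close>. On the sphere of dimension \<open>d\<close> the inner product with a fixed point, for a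
  uniformly distributed random point, has the law of \<open>cos \<theta>\<close> with density proportional to
  \<open>sin \<theta> ^ e\<close> on \<open>[0, \<pi>]\<close>; let \<open>N e\<close> be the corresponding mean and let \<open>q n e\<close> be its orthogonal
  polynomials (the Gegenbauer polynomials with parameter \<open>e / 2\<close>, up to positive factors). The
  proof rests on Schoenberg's description of positive definiteness by the coefficients
  \<open>N e (F * q n e)\<close>, applied to matrix-valued functions: with times \<open>t i\<close> and weights \<open>a i\<close>
  fixed, a function \<open>f (x, t)\<close> is treated as the matrix \<open>f (x, t i - t j)\<close> of functions of \<open>x\<close>.

  Why differentiation moves the dimension up by two. Integration by parts in \<open>\<theta>\<close> gives
  \<open>N e (f * q (n + 1) e) = \<kappa> * N (e + 2) (f' * q n (e + 2))\<close> with a constant \<open>\<kappa> > 0\<close>, because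
  \<open>- (q n (e + 2) * sin ^ (e + 1))'\<close>, as a derivative in \<open>x = cos \<theta>\<close>, is \<open>q (n + 1) e\<close> times
  \<open>sin ^ (e - 1)\<close>. This identity is \<open>gegenbauer_stein\<close>; it also serves to define the polynomials and
  yields their orthogonality. So the coefficients of the derivative on the larger sphere are
  positive multiples of coefficients of \<open>f\<close> on the smaller one, and two implications remain.

  Analysis (\<open>gegenbauer_coefficient_nonneg\<close>): a positive definite \<open>F\<close> has coefficients
  \<open>N e (F * q n e) \<ge> 0\<close>. Integrating the kernel \<open>F\<langle>\<xi>, \<zeta>\<rangle>\<close> against
  \<open>q n e \<langle>\<xi>, \<eta>\<rangle> * q n e \<langle>\<zeta>, \<eta>\<rangle>\<close> over both variables gives a nonnegative number, and the
  Funk--Hecke formula (\<open>funk_hecke\<close>: convolution with a zonal function multiplies the kernel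
  \<open>q n e \<langle>\<xi>, \<eta>\<rangle>\<close> by a number) identifies it with a positive multiple of the coefficient.

  Synthesis (\<open>zonal_synthesis\<close>): a continuous matrix-valued function with positive semidefinite
  coefficients is positive definite. Convolving it with \<open>(1 + \<langle>\<zeta>, \<eta>\<rangle>) ^ m\<close>, suitably normalised,
  approximates it as \<open>m\<close> grows. This polynomial is itself positive definite, hence by analysis a
  nonnegative combination of the \<open>q n e\<close>, and by Funk--Hecke the convolution is a nonnegative
  combination of coefficient times \<open>q n e \<langle>\<xi>, \<eta>\<rangle>\<close>; each such product is positive semidefinite
  because \<open>q n e \<langle>\<xi>, \<eta>\<rangle>\<close> reproduces itself under convolution (\<open>gegenbauer_schur_product\<close>).

  The uniform measure on the sphere is built by recursion on the dimension in polar coordinates.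
  Instead of proving that it is rotation invariant, one computes its moments
  (\<open>sphere_inner_moment\<close>): the mean of \<open>\<langle>\<xi>, \<eta>\<rangle> ^ k\<close> depends on \<open>\<eta>\<close> only through its norm.
  Polarising this, i.e. replacing \<open>\<eta>\<close> by \<open>s * \<xi> + \<eta>\<close> and comparing powers of \<open>s\<close>, turns
  convolutions of zonal polynomials into zonal polynomials of controlled degree, and orthogonality
  then gives the Funk--Hecke formula.
\<close>

section \<open>The zonal mean and ultraspherical polynomials\<close>

text \<open>
  Parametrising by the angle keeps the weight \<open>(1 - x\<^sup>2) ^ ((e - 1) / 2)\<close> bounded for \<open>e = 0\<close>, the
  circle, where as a density in \<open>x\<close> it is singular at the endpoints.
\<close>

definition zonal_mean :: "nat \<Rightarrow> (real \<Rightarrow> real) \<Rightarrow> real"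
  where "zonal_mean e F =
    integral {0..pi} (\<lambda>\<theta>. F (cos \<theta>) * sin \<theta> ^ e) / integral {0..pi} (\<lambda>\<theta>. sin \<theta> ^ e)"

lemma cos_in_Icc: "cos (\<theta>::real) \<in> {-1..1}"
  by simp

lemma continuous_on_cos_comp:
  fixes F :: "real \<Rightarrow> real"
  assumes "continuous_on {-1..1} F"
  shows "continuous_on S (\<lambda>\<theta>. F (cos \<theta>))"
  by (rule continuous_on_compose2[OF assms]) (auto intro!: continuous_intros)

lemma integrable_zonal:
  fixes F :: "real \<Rightarrow> real"
  assumes "continuous_on {-1..1} F"
  shows "(\<lambda>\<theta>. F (cos \<theta>) * sin \<theta> ^ e) integrable_on {0..pi}"
  by (intro integrable_continuous_interval continuous_intros continuous_on_cos_comp assms)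

lemma sin_power_integral_pos: "integral {0..pi} (\<lambda>\<theta>::real. sin \<theta> ^ e) > 0"
proof -
  have c: "continuous_on {0..pi} (\<lambda>\<theta>::real. sin \<theta> ^ e)"
    by (intro continuous_intros)
  have nn: "sin \<theta> ^ e \<ge> 0" if "\<theta> \<in> {0..pi}" for \<theta> :: real
    using that by (simp add: sin_ge_zero)
  have "integral {0..pi} (\<lambda>\<theta>::real. sin \<theta> ^ e) \<noteq> 0"
    using integral_eq_0_iff[OF c _ nn] by (auto intro!: bexI[of _ "pi/2"])
  moreover have "integral {0..pi} (\<lambda>\<theta>::real. sin \<theta> ^ e) \<ge> 0"
    by (intro integral_nonneg integrable_continuous_interval c nn)
  ultimately show ?thesis by simp
qed

lemma zonal_mean_cong:
  assumes "\<And>x. x \<in> {-1..1} \<Longrightarrow> F x = G x"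
  shows "zonal_mean e F = zonal_mean e G"
  using assms[OF cos_in_Icc] by (simp add: zonal_mean_def)

lemma zonal_mean_const [simp]: "zonal_mean e (\<lambda>x. c) = c"
  using sin_power_integral_pos[of e] by (simp add: zonal_mean_def)

lemma zonal_mean_cmult: "zonal_mean e (\<lambda>x. c * F x) = c * zonal_mean e F"
  by (simp add: zonal_mean_def mult.assoc)

lemma zonal_mean_add:
  assumes "continuous_on {-1..1} F" "continuous_on {-1..1} G"
  shows "zonal_mean e (\<lambda>x. F x + G x) = zonal_mean e F + zonal_mean e G"
  unfolding zonal_mean_def
  by (simp add: distrib_right integral_add[OF integrable_zonal integrable_zonal] assms add_divide_distrib)

lemma zonal_mean_diff:
  assumes "continuous_on {-1..1} F" "continuous_on {-1..1} G"
  shows "zonal_mean e (\<lambda>x. F x - G x) = zonal_mean e F - zonal_mean e G"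
  unfolding zonal_mean_def
  by (simp add: left_diff_distrib integral_diff[OF integrable_zonal integrable_zonal] assms diff_divide_distrib)

lemma zonal_mean_sum:
  assumes "finite I" "\<And>i. i \<in> I \<Longrightarrow> continuous_on {-1..1} (F i)"
  shows "zonal_mean e (\<lambda>x. \<Sum>i\<in>I. F i x) = (\<Sum>i\<in>I. zonal_mean e (F i))"
  using assms
proof (induction I rule: finite_induct)
  case (insert i I)
  have "continuous_on {-1..1} (\<lambda>x. \<Sum>i\<in>I. F i x)"
    by (intro continuous_intros) (use insert in auto)
  then show ?case using insert by (simp add: zonal_mean_add)
qed simp

lemma zonal_mean_mono:
  assumes "continuous_on {-1..1} F" "continuous_on {-1..1} G"
    and "\<And>x. x \<in> {-1..1} \<Longrightarrow> F x \<le> G x"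
  shows "zonal_mean e F \<le> zonal_mean e G"
proof -
  have "integral {0..pi} (\<lambda>\<theta>. F (cos \<theta>) * sin \<theta> ^ e) \<le> integral {0..pi} (\<lambda>\<theta>. G (cos \<theta>) * sin \<theta> ^ e)"
    by (intro integral_le integrable_zonal assms mult_right_mono)
       (auto simp: sin_ge_zero intro!: zero_le_power)
  then show ?thesis
    using sin_power_integral_pos[of e] by (simp add: zonal_mean_def divide_right_mono)
qed

lemma zonal_mean_eq_0_D:
  assumes "continuous_on {-1..1} F" "\<And>x. x \<in> {-1..1} \<Longrightarrow> F x \<ge> 0"
    and "zonal_mean e F = 0" "x \<in> {-1<..<1}"
  shows "F x = 0"
proof -
  have c: "continuous_on {0..pi} (\<lambda>\<theta>. F (cos \<theta>) * sin \<theta> ^ e)"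
    by (intro continuous_intros continuous_on_cos_comp assms)
  have nn: "F (cos \<theta>) * sin \<theta> ^ e \<ge> 0" if "\<theta> \<in> {0..pi}" for \<theta> :: real
    using that by (intro mult_nonneg_nonneg assms) (auto simp: sin_ge_zero)
  have "integral {0..pi} (\<lambda>\<theta>. F (cos \<theta>) * sin \<theta> ^ e) = 0"
    using assms(3) sin_power_integral_pos[of e] by (simp add: zonal_mean_def)
  then have z: "\<forall>\<theta>\<in>{0..pi}. F (cos \<theta>) * sin \<theta> ^ e = 0"
    using integral_eq_0_iff[OF c _ nn] by simp
  have "0 \<le> arccos x" "arccos x \<le> pi" "cos (arccos x) = x" "sin (arccos x) \<noteq> 0"
    using assms(4) arccos_lbound[of x] arccos_ubound[of x] sin_arccos_nonzero[of x] by auto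
  then show ?thesis using z by force
qed

text \<open>
  This is the integral of the derivative of \<open>G (cos \<theta>) * sin \<theta> ^ (e + 1)\<close>, which vanishes at \<open>0\<close> and
  at \<open>\<pi>\<close>. It is the only source of explicit values of \<^const>\<open>zonal_mean\<close> below: orthogonality of the
  polynomials, the moments of the weight and the concentration of \<open>(1 + x) ^ m\<close> near \<open>1\<close> are all
  obtained by choosing \<open>G\<close>.
\<close>

lemma zonal_mean_stein:
  fixes G G' :: "real \<Rightarrow> real"
  assumes der: "\<And>x. x \<in> {-1..1} \<Longrightarrow> (G has_real_derivative G' x) (at x within {-1..1})"
    and cont: "continuous_on {-1..1} G'"
  shows "(real e + 1) * zonal_mean e (\<lambda>x. x * G x) = zonal_mean e (\<lambda>x. (1 - x\<^sup>2) * G' x)"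
proof -
  have contG: "continuous_on {-1..1} G"
    by (rule DERIV_continuous_on) (rule der)
  let ?h = "\<lambda>\<theta>. (real e + 1) * (cos \<theta> * G (cos \<theta>) * sin \<theta> ^ e) - (1 - (cos \<theta>)\<^sup>2) * G' (cos \<theta>) * sin \<theta> ^ e"
  have "((\<lambda>\<theta>. G (cos \<theta>) * sin \<theta> ^ Suc e) has_real_derivative ?h \<theta>) (at \<theta> within {0..pi})" for \<theta> :: real
  proof -
    have "((\<lambda>\<theta>. G (cos \<theta>)) has_real_derivative G' (cos \<theta>) * (- sin \<theta>)) (at \<theta> within {0..pi})"
    proof -
      have "(G has_real_derivative G' (cos \<theta>)) (at (cos \<theta>) within cos ` {0..pi})"
        by (rule DERIV_subset[OF der]) auto
      moreover have "(cos has_real_derivative - sin \<theta>) (at \<theta> within {0..pi})"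
        by (auto intro!: derivative_eq_intros)
      ultimately show ?thesis
        using DERIV_image_chain by (fastforce simp: o_def)
    qed
    moreover have "((\<lambda>\<theta>. sin \<theta> ^ Suc e) has_real_derivative (1 + real e) * (cos \<theta> * sin \<theta> ^ e)) (at \<theta> within {0..pi})"
      by (rule DERIV_power_Suc) (auto intro!: derivative_eq_intros)
    ultimately have "((\<lambda>\<theta>. G (cos \<theta>) * sin \<theta> ^ Suc e) has_real_derivative
        G' (cos \<theta>) * (- sin \<theta>) * sin \<theta> ^ Suc e + (1 + real e) * (cos \<theta> * sin \<theta> ^ e) * G (cos \<theta>)) (at \<theta> within {0..pi})"
      by (rule DERIV_mult)
    moreover have "1 - (cos \<theta>)\<^sup>2 = sin \<theta> * sin \<theta>"
      using sin_squared_eq[of \<theta>] by (simp only: power2_eq_square)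
    then have "G' (cos \<theta>) * (- sin \<theta>) * sin \<theta> ^ Suc e + (1 + real e) * (cos \<theta> * sin \<theta> ^ e) * G (cos \<theta>) = ?h \<theta>"
      by (simp only: power_Suc) (simp add: algebra_simps)
    ultimately show ?thesis by (simp only:)
  qed
  then have "(?h has_integral G (cos pi) * sin pi ^ Suc e - G (cos 0) * sin 0 ^ Suc e) {0..pi}"
    by (intro fundamental_theorem_of_calculus)
       (auto simp flip: has_real_derivative_iff_has_vector_derivative)
  then have "integral {0..pi} ?h = 0"
    by (simp add: integral_unique)
  moreover have "integral {0..pi} ?h =
      (real e + 1) * integral {0..pi} (\<lambda>\<theta>. cos \<theta> * G (cos \<theta>) * sin \<theta> ^ e)
      - integral {0..pi} (\<lambda>\<theta>. (1 - (cos \<theta>)\<^sup>2) * G' (cos \<theta>) * sin \<theta> ^ e)"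
    by (subst integral_diff)
       (auto intro!: integrable_continuous_interval continuous_intros continuous_on_cos_comp contG cont)
  ultimately show ?thesis
    by (simp add: zonal_mean_def field_simps)
qed

text \<open>
  The factor \<open>1 - x\<^sup>2 = sin\<^sup>2 \<theta>\<close> that integration by parts produces is exactly what separates the
  weights of spheres whose dimensions differ by two.
\<close>

lemma zonal_mean_weight_shift:
  "zonal_mean e (\<lambda>x. (1 - x\<^sup>2) * F x) =
     integral {0..pi} (\<lambda>\<theta>. sin \<theta> ^ (e + 2)) / integral {0..pi} (\<lambda>\<theta>. sin \<theta> ^ e) * zonal_mean (e + 2) F"
proof -
  have "(1 - (cos \<theta>)\<^sup>2) * F (cos \<theta>) * sin \<theta> ^ e = F (cos \<theta>) * sin \<theta> ^ (e + 2)" for \<theta> :: real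
    by (simp only: sin_squared_eq[symmetric]) (simp add: power_add power2_eq_square mult_ac)
  then show ?thesis
    unfolding zonal_mean_def using sin_power_integral_pos[of "e + 2"] by (simp only:) simp
qed

text \<open>
  Up to a positive factor this is the Gegenbauer polynomial of degree \<open>n\<close> with parameter \<open>e / 2\<close> (the
  Chebyshev polynomial for \<open>e = 0\<close>). The recursion is the adjoint of differentiation,
  \<open>q (n + 1) e * w e = - (q n (e + 2) * w (e + 2))'\<close> with \<open>w e = (1 - x\<^sup>2) ^ ((e - 1) / 2)\<close>, so that
  raising the degree by one lowers the dimension of the sphere by two. The normalisation only
  matters through its sign, which is fixed by positivity at \<open>1\<close>.
\<close>

fun gegenbauer :: "nat \<Rightarrow> nat \<Rightarrow> real poly"
  where
    "gegenbauer 0 e = 1"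
  | "gegenbauer (Suc n) e =
      smult (real e + 1) ([:0, 1:] * gegenbauer n (e + 2)) - [:1, 0, -1:] * pderiv (gegenbauer n (e + 2))"

text \<open>
  Apply the integration by parts to \<open>F\<close> times the polynomial of the larger sphere: the terms without
  \<open>F'\<close> make up the next polynomial of the smaller sphere.
\<close>

lemma gegenbauer_stein:
  fixes F F' :: "real \<Rightarrow> real"
  assumes der: "\<And>x. x \<in> {-1..1} \<Longrightarrow> (F has_real_derivative F' x) (at x within {-1..1})"
    and cont: "continuous_on {-1..1} F'"
  shows "zonal_mean e (\<lambda>x. F x * poly (gegenbauer (Suc n) e) x)
    = zonal_mean e (\<lambda>x. (1 - x\<^sup>2) * (F' x * poly (gegenbauer n (e + 2)) x))"
proof -
  define q where "q = gegenbauer n (e + 2)"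
  have contF: "continuous_on {-1..1} F"
    by (rule DERIV_continuous_on) (rule der)
  note [continuous_intros] = contF cont
  have "(real e + 1) * zonal_mean e (\<lambda>x. x * (F x * poly q x))
      = zonal_mean e (\<lambda>x. (1 - x\<^sup>2) * (F' x * poly q x + F x * poly (pderiv q) x))"
    by (rule zonal_mean_stein)
       (auto intro!: continuous_intros derivative_eq_intros der DERIV_subset[OF poly_DERIV] simp: mult.commute)
  also have "\<dots> = zonal_mean e (\<lambda>x. (1 - x\<^sup>2) * (F' x * poly q x)) + zonal_mean e (\<lambda>x. (1 - x\<^sup>2) * F x * poly (pderiv q) x)"
    by (subst zonal_mean_add[symmetric]) (auto intro!: continuous_intros simp: algebra_simps)
  finally have "zonal_mean e (\<lambda>x. (1 - x\<^sup>2) * (F' x * poly q x))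
     = zonal_mean e (\<lambda>x. (real e + 1) * (x * (F x * poly q x))) - zonal_mean e (\<lambda>x. (1 - x\<^sup>2) * F x * poly (pderiv q) x)"
    by (simp add: zonal_mean_cmult)
  also have "\<dots> = zonal_mean e (\<lambda>x. F x * poly (gegenbauer (Suc n) e) x)"
    by (subst zonal_mean_diff[symmetric])
       (auto intro!: continuous_intros zonal_mean_cong simp: q_def algebra_simps power2_eq_square)
  finally show ?thesis by (simp add: q_def)
qed

lemma degree_gegenbauer_le: "degree (gegenbauer n e) \<le> n"
proof (induction n arbitrary: e)
  case (Suc n)
  have "degree ([:0, 1:] * gegenbauer n (e + 2)) \<le> Suc n"
    using degree_mult_le[of "[:0, 1:]" "gegenbauer n (e + 2)"] Suc[of "e + 2"] by simp
  moreover have "degree ([:1, 0, -1:] * pderiv (gegenbauer n (e + 2))) \<le> Suc n"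
  proof (cases n)
    case (Suc k)
    then show ?thesis
      using degree_mult_le[of "[:1, 0, -1:]" "pderiv (gegenbauer n (e + 2))"] Suc.IH[of "e + 2"]
      by (simp add: degree_pderiv numeral_2_eq_2)
  qed (simp add: pderiv_1)
  ultimately show ?case
    unfolding gegenbauer.simps by (intro degree_diff_le order_trans[OF degree_smult_le])
qed simp

lemma gegenbauer_at_1_pos: "poly (gegenbauer n e) 1 > 0"
  by (induction n arbitrary: e) (auto simp: add_nonneg_pos)

text \<open>
  Moving the derivative onto \<open>r\<close> lowers both degrees by one, so the claim descends to a constant
  \<open>r\<close>, whose derivative vanishes.
\<close>

lemma gegenbauer_orthogonal:
  assumes "degree r < n"
  shows "zonal_mean e (\<lambda>x. poly r x * poly (gegenbauer n e) x) = 0"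
  using assms
proof (induction n arbitrary: e r)
  case (Suc n)
  have "zonal_mean e (\<lambda>x. poly r x * poly (gegenbauer (Suc n) e) x)
      = zonal_mean e (\<lambda>x. (1 - x\<^sup>2) * (poly (pderiv r) x * poly (gegenbauer n (e + 2)) x))"
    by (rule gegenbauer_stein) (auto intro!: continuous_intros DERIV_subset[OF poly_DERIV])
  also have "zonal_mean (e + 2) (\<lambda>x. poly (pderiv r) x * poly (gegenbauer n (e + 2)) x) = 0"
  proof (cases "degree r = 0")
    case True
    then show ?thesis by (simp add: pderiv_eq_0_iff[THEN iffD2])
  next
    case False
    then show ?thesis using Suc by (simp add: degree_pderiv)
  qed
  then have "zonal_mean e (\<lambda>x. (1 - x\<^sup>2) * (poly (pderiv r) x * poly (gegenbauer n (e + 2)) x)) = 0"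
    by (simp only: zonal_mean_weight_shift mult_zero_right)
  finally show ?case .
qed simp

lemma poly_eq_0_if_zonal_square_0:
  assumes "zonal_mean e (\<lambda>x. poly p x * poly p x) = 0"
  shows "p = 0"
proof (rule ccontr)
  assume "p \<noteq> 0"
  then have "finite {x. poly p x = 0}" by (rule poly_roots_finite)
  moreover have "poly p x = 0" if "x \<in> {-1<..<1}" for x
  proof -
    have "poly p x * poly p x = 0"
      by (rule zonal_mean_eq_0_D[OF _ _ assms that]) (auto intro!: continuous_intros)
    then show ?thesis by simp
  qed
  then have "{-1<..<1} \<subseteq> {x. poly p x = 0}" by blast
  ultimately have "finite {-1<..<1::real}" by (rule finite_subset[rotated])
  then show False by (simp add: infinite_Ioo)
qed

lemma gegenbauer_nonzero: "gegenbauer n e \<noteq> 0"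
  using gegenbauer_at_1_pos[of n e] by auto

lemma gegenbauer_square_pos: "zonal_mean e (\<lambda>x. poly (gegenbauer n e) x * poly (gegenbauer n e) x) > 0"
proof -
  have "zonal_mean e (\<lambda>x. 0) \<le> zonal_mean e (\<lambda>x. poly (gegenbauer n e) x * poly (gegenbauer n e) x)"
    by (rule zonal_mean_mono) (auto intro!: continuous_intros)
  then show ?thesis
    using poly_eq_0_if_zonal_square_0[of e "gegenbauer n e"] gegenbauer_nonzero[of n e]
    unfolding zonal_mean_const less_le by metis
qed

lemma degree_lt_if_coeff_0:
  assumes "degree p \<le> n" "coeff p n = 0" "p \<noteq> 0"
  shows "degree p < n"
proof -
  have "degree p \<noteq> n"
    using assms(2,3) leading_coeff_0_iff[of p] by auto
  then show ?thesis using assms(1) by simp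
qed

lemma coeff_gegenbauer_nonzero: "coeff (gegenbauer n e) n \<noteq> 0"
proof
  assume 0: "coeff (gegenbauer n e) n = 0"
  have "degree (gegenbauer n e) < n"
    using degree_lt_if_coeff_0 degree_gegenbauer_le 0 gegenbauer_nonzero by blast
  then show False
    using gegenbauer_orthogonal[of "gegenbauer n e" n e] gegenbauer_square_pos[of e n] by simp
qed

text \<open>
  A combination of \<open>R\<close> and the Gegenbauer polynomial that cancels the coefficient of \<open>x ^ n\<close> has degree
  below \<open>n\<close> and is orthogonal to all such polynomials, in particular to itself. The resulting factor
  is read off at \<open>x = 1\<close>, where the Gegenbauer polynomial does not vanish.
\<close>

lemma gegenbauer_unique:
  assumes deg: "degree R \<le> n"
    and orth: "\<And>r. degree r < n \<Longrightarrow> zonal_mean e (\<lambda>x. poly r x * poly R x) = 0"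
  shows "R = smult (poly R 1 / poly (gegenbauer n e) 1) (gegenbauer n e)"
proof -
  define q where "q = gegenbauer n e"
  define a where "a = coeff q n"
  define b where "b = coeff R n"
  have a: "a \<noteq> 0" by (simp add: a_def q_def coeff_gegenbauer_nonzero)
  \<comment> \<open>The coefficient of \<open>x ^ n\<close> cancels.\<close>
  define U where "U = smult a R - smult b q"
  have U0: "coeff U n = 0" by (simp add: U_def a_def b_def)
  have dU: "degree U \<le> n"
    unfolding U_def q_def
    by (intro degree_diff_le order_trans[OF degree_smult_le] deg degree_gegenbauer_le)
  have "U = 0"
  proof (rule ccontr)
    assume "U \<noteq> 0"
    then have d: "degree U < n" using degree_lt_if_coeff_0 dU U0 by blast
    have "zonal_mean e (\<lambda>x. poly U x * poly U x)
       = zonal_mean e (\<lambda>x. a * (poly U x * poly R x) - b * (poly U x * poly q x))"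
      by (rule zonal_mean_cong) (simp add: U_def algebra_simps)
    also have "\<dots> = a * zonal_mean e (\<lambda>x. poly U x * poly R x) - b * zonal_mean e (\<lambda>x. poly U x * poly q x)"
      by (subst zonal_mean_diff) (auto intro!: continuous_intros simp: zonal_mean_cmult)
    also have "\<dots> = 0"
      using orth[OF d] gegenbauer_orthogonal[OF d, of e] by (simp add: q_def)
    finally show False using poly_eq_0_if_zonal_square_0 \<open>U \<noteq> 0\<close> by blast
  qed
  then have *: "smult a R = smult b q" by (simp add: U_def)
  have "R = smult (1 / a) (smult a R)" using a by simp
  also have "\<dots> = smult (b / a) q" by (simp add: *)
  finally have R: "R = smult (b / a) q" .
  then have "poly R 1 = b / a * poly q 1" by simp
  moreover have "poly q 1 \<noteq> 0" using gegenbauer_at_1_pos[of n e] by (simp add: q_def)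
  ultimately have "poly R 1 / poly q 1 = b / a" by simp
  then show ?thesis using R by (simp add: q_def)
qed

lemma gegenbauer_expansion:
  assumes "degree p \<le> m"
  shows "p = (\<Sum>n\<le>m. smult (zonal_mean e (\<lambda>x. poly p x * poly (gegenbauer n e) x)
      / zonal_mean e (\<lambda>x. poly (gegenbauer n e) x * poly (gegenbauer n e) x)) (gegenbauer n e))"
proof -
  define N where "N r s = zonal_mean e (\<lambda>x. poly r x * poly s x)" for r s
  have Nadd: "N (r + s) u = N r u + N s u" for r s u
    unfolding N_def by (subst zonal_mean_add[symmetric]) (auto intro!: continuous_intros simp: algebra_simps)
  have Nsm: "N (smult c r) u = c * N r u" for c r u
    unfolding N_def by (subst zonal_mean_cmult[symmetric]) (simp add: algebra_simps)
  have Nsum: "N (\<Sum>i\<in>I. f i) u = (\<Sum>i\<in>I. N (f i) u)" if "finite I" for f :: "nat \<Rightarrow> real poly" and I u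
    using that by (induction I rule: finite_induct) (auto simp: Nadd, simp add: N_def)
  have sym: "N r s = N s r" for r s by (simp add: N_def mult.commute)
  let ?q = "\<lambda>n. gegenbauer n e"
  have orth: "N (?q i) (?q j) = 0" if "i \<noteq> j" for i j
  proof -
    have *: "N (?q i) (?q j) = 0" if "i < j" for i j
      unfolding N_def using that degree_gegenbauer_le[of i e] by (intro gegenbauer_orthogonal) simp
    show ?thesis using that *[of i j] *[of j i] sym by (cases "i < j") auto
  qed
  have "\<exists>k. p = (\<Sum>n\<le>m. smult (k n) (?q n))"
    using assms
  proof (induction m arbitrary: p)
    case 0
    then obtain c where "p = [:c:]" by (auto elim: degree_eq_zeroE)
    then show ?case by (intro exI[of _ "\<lambda>_. c"]) (simp add: one_pCons)
  next
    case (Suc m)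
    define c where "c = coeff p (Suc m) / coeff (?q (Suc m)) (Suc m)"
    define p' where "p' = p - smult c (?q (Suc m))"
    have "coeff p' (Suc m) = 0"
      using coeff_gegenbauer_nonzero[of "Suc m" e] by (simp add: p'_def c_def)
    moreover have "degree p' \<le> Suc m"
      unfolding p'_def by (intro degree_diff_le Suc order_trans[OF degree_smult_le] degree_gegenbauer_le)
    ultimately have "degree p' \<le> m"
      using degree_lt_if_coeff_0[of p' "Suc m"] by (cases "p' = 0") auto
    then obtain k where k: "p' = (\<Sum>n\<le>m. smult (k n) (?q n))" using Suc.IH by blast
    have "p = (\<Sum>n\<le>Suc m. smult ((k(Suc m := c)) n) (?q n))"
      using k by (simp add: p'_def algebra_simps del: gegenbauer.simps)
    then show ?case by blast
  qed
  then obtain k where k: "p = (\<Sum>n\<le>m. smult (k n) (?q n))" by blast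
  have "N p (?q j) = k j * N (?q j) (?q j)" if "j \<le> m" for j
  proof -
    have "N p (?q j) = (\<Sum>n\<le>m. k n * N (?q n) (?q j))"
      unfolding k by (simp add: Nsum Nsm)
    also have "\<dots> = (\<Sum>n\<le>m. if n = j then k n * N (?q n) (?q j) else 0)"
      by (intro sum.cong) (auto simp: orth)
    finally show ?thesis using that by (simp add: sum.delta)
  qed
  then have "k j = N p (?q j) / N (?q j) (?q j)" if "j \<le> m" for j
    using that gegenbauer_square_pos[of e j] by (simp add: N_def field_simps)
  then have "(\<Sum>n\<le>m. smult (k n) (?q n)) = (\<Sum>n\<le>m. smult (N p (?q n) / N (?q n) (?q n)) (?q n))"
    by (intro sum.cong refl arg_cong2[where f = smult]) auto
  with k have "p = (\<Sum>n\<le>m. smult (N p (?q n) / N (?q n) (?q n)) (?q n))" by (rule trans)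
  then show ?thesis by (simp only: N_def)
qed

section \<open>The uniform measure on the sphere and its moments\<close>

text \<open>
  The choice \<open>x ^ k * (1 - x\<^sup>2) ^ j\<close> in the integration by parts trades two powers of \<open>x\<close> for one factor
  \<open>1 - x\<^sup>2\<close>; at \<open>k = 0\<close> the right-hand side is zero, whatever the truncated exponent \<open>k - 1\<close> means.
\<close>

lemma zonal_mean_moment_step:
  "(real e + 1 + 2 * real j) * zonal_mean e (\<lambda>x. x ^ (k + 1) * (1 - x\<^sup>2) ^ j)
    = real k * zonal_mean e (\<lambda>x. x ^ (k - 1) * (1 - x\<^sup>2) ^ Suc j)"
proof -
  let ?G = "\<lambda>x::real. x ^ k * (1 - x\<^sup>2) ^ j"
  let ?G' = "\<lambda>x::real. real k * x ^ (k - 1) * (1 - x\<^sup>2) ^ j - 2 * real j * x ^ (k + 1) * (1 - x\<^sup>2) ^ (j - 1)"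
  have "(real e + 1) * zonal_mean e (\<lambda>x. x * ?G x) = zonal_mean e (\<lambda>x. (1 - x\<^sup>2) * ?G' x)"
    by (rule zonal_mean_stein)
       (auto intro!: derivative_eq_intros continuous_intros simp: algebra_simps)
  also have "\<dots> = zonal_mean e (\<lambda>x. real k * (x ^ (k - 1) * (1 - x\<^sup>2) ^ Suc j) - 2 * real j * (x ^ (k + 1) * (1 - x\<^sup>2) ^ j))"
    by (cases j) (simp_all add: algebra_simps)
  also have "\<dots> = real k * zonal_mean e (\<lambda>x. x ^ (k - 1) * (1 - x\<^sup>2) ^ Suc j)
      - 2 * real j * zonal_mean e (\<lambda>x. x ^ (k + 1) * (1 - x\<^sup>2) ^ j)"
    by (subst zonal_mean_diff) (auto intro!: continuous_intros simp: zonal_mean_cmult)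
  finally show ?thesis by (simp add: algebra_simps)
qed

lemma zonal_mean_odd_moment: "zonal_mean e (\<lambda>x. x ^ (2 * a + 1) * (1 - x\<^sup>2) ^ j) = 0"
proof (induction a arbitrary: j)
  case 0
  have "(real e + 1 + 2 * real j) * zonal_mean e (\<lambda>x. x ^ (0 + 1) * (1 - x\<^sup>2) ^ j) = 0"
    by (subst zonal_mean_moment_step) simp
  moreover have "real e + 1 + 2 * real j \<noteq> 0" by linarith
  ultimately show ?case by simp
next
  case (Suc a)
  have "(real e + 1 + 2 * real j) * zonal_mean e (\<lambda>x. x ^ ((2 * a + 2) + 1) * (1 - x\<^sup>2) ^ j) = 0"
    using Suc[of "Suc j"] by (subst zonal_mean_moment_step) simp
  moreover have "real e + 1 + 2 * real j \<noteq> 0" by linarith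
  moreover have "2 * Suc a + 1 = (2 * a + 2) + 1" by simp
  ultimately show ?case by (simp only:) simp
qed

text \<open>
  A quotient of Beta functions in which only rational factors survive; Pochhammer symbols make it
  accessible to induction.
\<close>

lemma zonal_mean_even_moment:
  "zonal_mean e (\<lambda>x. x ^ (2 * a) * (1 - x\<^sup>2) ^ j)
     = pochhammer (1/2) a * pochhammer ((real e + 1) / 2) j / pochhammer ((real e + 2) / 2) (a + j)"
proof (induction a arbitrary: j)
  case 0
  show ?case
  proof (induction j)
    case (Suc j)
    let ?I = "\<lambda>k j. zonal_mean e (\<lambda>x. x ^ k * (1 - x\<^sup>2) ^ j)"
    have "(real e + 1 + 2 * real j) * ?I 2 j = ?I 0 (Suc j)"
      using zonal_mean_moment_step[of e j 1] by (simp add: numeral_2_eq_2)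
    moreover have "?I 0 (Suc j) = ?I 0 j - ?I 2 j"
      by (subst zonal_mean_diff[symmetric]) (auto intro!: continuous_intros simp: algebra_simps)
    moreover have "c * A = B \<Longrightarrow> B = C - A \<Longrightarrow> (c + 1) * B = c * C" for c A B C :: real
      by algebra
    ultimately have "(real e + 1 + 2 * real j + 1) * ?I 0 (Suc j) = (real e + 1 + 2 * real j) * ?I 0 j"
      by blast
    then have "(real e + 2 + 2 * real j) * ?I 0 (Suc j) = (real e + 1 + 2 * real j) * ?I 0 j"
      by (simp add: add_ac)
    moreover have pos: "real e + 2 + 2 * real j > 0" by linarith
    ultimately have "?I 0 (Suc j) = (real e + 1 + 2 * real j) * ?I 0 j / (real e + 2 + 2 * real j)"
      by (simp add: field_simps)
    also have "\<dots> = ((real e + 1) / 2 + real j) / ((real e + 2) / 2 + real j) * ?I 0 j"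
      using pos by (simp add: field_simps)
    also have "\<dots> = pochhammer ((real e + 1) / 2) (Suc j) / pochhammer ((real e + 2) / 2) (Suc j)"
      using Suc by (simp add: pochhammer_Suc mult.commute)
    finally show ?case by simp
  qed simp
next
  case (Suc a)
  let ?I = "\<lambda>k j. zonal_mean e (\<lambda>x. x ^ k * (1 - x\<^sup>2) ^ j)"
  have pos: "real e + 1 + 2 * real j > 0" by linarith
  have "(real e + 1 + 2 * real j) * ?I (2 * Suc a) j = real (2 * a + 1) * ?I (2 * a) (Suc j)"
    using zonal_mean_moment_step[of e j "2 * a + 1"] by simp
  then have "?I (2 * Suc a) j = real (2 * a + 1) * ?I (2 * a) (Suc j) / (real e + 1 + 2 * real j)"
    using pos by (simp add: field_simps)
  also have "\<dots> = (1/2 + real a) * ?I (2 * a) (Suc j) / ((real e + 1) / 2 + real j)"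
    using pos by (simp add: field_simps)
  also have "\<dots> = (1/2 + real a) * (pochhammer (1/2) a * (pochhammer ((real e + 1) / 2) j * ((real e + 1) / 2 + real j))
      / pochhammer ((real e + 2) / 2) (Suc a + j)) / ((real e + 1) / 2 + real j)"
    by (simp only: Suc.IH pochhammer_Suc[of "(real e + 1) / 2" j] add_Suc add_Suc_right)
  also have "\<dots> = pochhammer (1/2) (Suc a) * pochhammer ((real e + 1) / 2) j / pochhammer ((real e + 2) / 2) (Suc a + j)"
  proof -
    have "x * (P * (Q * y) / R) / y = P * x * Q / R" if "y \<noteq> 0" for x y P Q R :: real
      using that by simp
    moreover have "0 < (real e + 1) / 2 + real j" by (intro add_pos_nonneg) auto
    then have "(real e + 1) / 2 + real j \<noteq> 0" by (metis less_irrefl)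
    ultimately show ?thesis unfolding pochhammer_Suc[of "1/2" a] by blast
  qed
  finally show ?case .
qed

definition polar_angle_measure :: "nat \<Rightarrow> real measure"
  where "polar_angle_measure e = density lborel
    (\<lambda>\<theta>. ennreal (indicator {0..pi} \<theta> * sin \<theta> ^ e / integral {0..pi} (\<lambda>\<theta>. sin \<theta> ^ e)))"

lemma sets_polar_angle_measure [simp, measurable_cong]: "sets (polar_angle_measure e) = sets borel"
  by (simp add: polar_angle_measure_def)

lemma polar_angle_integral:
  fixes g :: "real \<Rightarrow> real"
  assumes "continuous_on UNIV g"
  shows "integrable (polar_angle_measure e) g" (is ?A)
    and "(\<integral>\<theta>. g \<theta> \<partial>polar_angle_measure e)
      = integral {0..pi} (\<lambda>\<theta>. g \<theta> * sin \<theta> ^ e) / integral {0..pi} (\<lambda>\<theta>. sin \<theta> ^ e)" (is ?B)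
proof -
  define W where "W = integral {0..pi} (\<lambda>\<theta>. sin \<theta> ^ e)"
  have W: "W > 0" by (simp add: W_def sin_power_integral_pos)
  have c: "continuous_on {0..pi} g" using assms continuous_on_subset by blast
  have m [measurable]: "g \<in> borel_measurable borel"
    using assms by (rule borel_measurable_continuous_onI)
  have si: "set_integrable lborel {0..pi} (\<lambda>\<theta>. g \<theta> * sin \<theta> ^ e / W)"
    by (intro borel_integrable_atLeastAtMost' continuous_intros c) (use W in auto)
  have nn: "AE \<theta> in lborel. 0 \<le> indicator {0..pi} \<theta> * sin \<theta> ^ e / W"
    using W by (intro AE_I2) (auto simp: indicator_def sin_ge_zero)
  have eq: "(\<lambda>\<theta>. (indicator {0..pi} \<theta> * sin \<theta> ^ e / W) *\<^sub>R g \<theta>)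
      = (\<lambda>\<theta>. indicator {0..pi} \<theta> *\<^sub>R (g \<theta> * sin \<theta> ^ e / W))"
    by (auto simp: fun_eq_iff)
  show ?A
    unfolding polar_angle_measure_def W_def[symmetric]
    by (subst integrable_density, measurable, rule nn)
       (use si in \<open>simp only: eq set_integrable_def\<close>)
  have "(\<integral>\<theta>. g \<theta> \<partial>polar_angle_measure e) = (LINT \<theta>:{0..pi}|lborel. g \<theta> * sin \<theta> ^ e / W)"
    unfolding polar_angle_measure_def W_def[symmetric]
    by (subst integral_density, measurable, rule nn) (simp only: eq set_lebesgue_integral_def)
  also have "\<dots> = integral {0..pi} (\<lambda>\<theta>. g \<theta> * sin \<theta> ^ e / W)"
    by (rule set_borel_integral_eq_integral(2)[OF si])
  finally show ?B by (simp add: W_def)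
qed

lemma polar_angle_integral_cos:
  assumes "continuous_on UNIV F"
  shows "(\<integral>\<theta>. F (cos \<theta>) \<partial>polar_angle_measure e) = zonal_mean e F"
  unfolding zonal_mean_def
  by (rule polar_angle_integral(2)) (auto intro!: continuous_on_compose2[OF assms] continuous_intros)

lemma prob_space_polar_angle_measure: "prob_space (polar_angle_measure e)"
proof -
  let ?M = "polar_angle_measure e"
  have i: "integrable ?M (\<lambda>_. 1::real)" by (rule polar_angle_integral) simp
  have "space ?M = UNIV" by (simp add: polar_angle_measure_def)
  have "finite_measure ?M"
  proof
    show "emeasure ?M (space ?M) \<noteq> \<infinity>"
      using i by (auto simp: integrable_iff_bounded)
  qed
  moreover have "(\<integral>_. 1 \<partial>?M) = (1::real)"
    using polar_angle_integral(2)[of "\<lambda>_. 1" e] sin_power_integral_pos[of e] by simp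
  then have "measure ?M (space ?M) = 1" by simp
  ultimately show ?thesis
    by (intro prob_spaceI) (simp add: finite_measure.emeasure_eq_measure)
qed

text \<open>
  The point of the next sphere with polar angle \<open>\<theta>\<close> and direction \<open>u\<close>; the pole is the new last
  coordinate axis, so that \<open>cos \<theta>\<close> is the new coordinate.
\<close>

definition polar_join :: "nat \<Rightarrow> real \<Rightarrow> (nat \<Rightarrow> real) \<Rightarrow> nat \<Rightarrow> real"
  where "polar_join d \<theta> u = (\<lambda>i. if i = Suc d then cos \<theta> else sin \<theta> * u i)"

text \<open>
  The uniform distribution on the sphere, as a measure on all sequences: two point masses on the
  sphere of dimension 0, then polar coordinates with angular density proportional to \<open>sin \<theta> ^ d\<close>.
\<close>

primrec sphere_measure :: "nat \<Rightarrow> (nat \<Rightarrow> real) measure"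
  where
    "sphere_measure 0 = distr (measure_pmf (pmf_of_set {-1, 1::real})) borel (\<lambda>s i. if i = 0 then s else 0)"
  | "sphere_measure (Suc d) =
      distr (polar_angle_measure d \<Otimes>\<^sub>M sphere_measure d) borel (\<lambda>(\<theta>, u). polar_join d \<theta> u)"

lemma sets_sphere_measure [simp, measurable_cong]: "sets (sphere_measure d) = sets borel"
  by (cases d) auto

lemma space_sphere_measure [simp]: "space (sphere_measure d) = UNIV"
  using sets_eq_imp_space_eq[OF sets_sphere_measure] by simp

lemma measurable_coordinate [measurable]: "(\<lambda>u::nat \<Rightarrow> real. u i) \<in> borel_measurable borel"
  by (rule borel_measurable_continuous_onI) (rule continuous_on_product_coordinates)

lemma measurable_polar_join [measurable]:
  "(\<lambda>(\<theta>, u). polar_join d \<theta> u) \<in> borel_measurable (polar_angle_measure d \<Otimes>\<^sub>M sphere_measure d)"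
  unfolding polar_join_def case_prod_beta
  by (rule measurable_coordinatewise_then_product) measurable

lemma prob_space_sphere_measure: "prob_space (sphere_measure d)"
proof (induction d)
  case 0
  show ?case unfolding sphere_measure.simps
    by (rule prob_space.prob_space_distr) (auto simp: prob_space_measure_pmf)
next
  case (Suc d)
  then show ?case unfolding sphere_measure.simps
    by (intro prob_space.prob_space_distr prob_space_pair prob_space_polar_angle_measure) measurable
qed

lemma mem_unit_sphere: "\<xi> \<in> unit_sphere d \<longleftrightarrow> (\<Sum>i\<le>d. \<xi> i * \<xi> i) = 1 \<and> (\<forall>i>d. \<xi> i = 0)"
  by (simp add: nsphere power2_eq_square)

lemma sphere_inner_self: "\<xi> \<in> unit_sphere d \<Longrightarrow> sphere_inner d \<xi> \<xi> = 1"
  by (simp add: mem_unit_sphere sphere_inner_def)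

lemma sphere_inner_commute: "sphere_inner d \<xi> \<eta> = sphere_inner d \<eta> \<xi>"
  by (simp add: sphere_inner_def mult.commute)

lemma sphere_inner_polar_join:
  "sphere_inner (Suc d) (polar_join d \<theta> u) \<eta> = sin \<theta> * sphere_inner d u \<eta> + cos \<theta> * \<eta> (Suc d)"
  by (simp add: sphere_inner_def polar_join_def sum_distrib_left mult.assoc)

lemma polar_join_in_sphere: "u \<in> unit_sphere d \<Longrightarrow> polar_join d \<theta> u \<in> unit_sphere (Suc d)"
proof -
  assume u: "u \<in> unit_sphere d"
  have "(\<Sum>i\<le>d. (sin \<theta> * u i) * (sin \<theta> * u i)) = sin \<theta> * sin \<theta> * (\<Sum>i\<le>d. u i * u i)"
    by (simp add: sum_distrib_left mult_ac)
  also have "\<dots> = (sin \<theta>)\<^sup>2" using u by (simp add: mem_unit_sphere power2_eq_square)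
  finally show ?thesis
    using u sin_cos_squared_add[of \<theta>] by (auto simp: mem_unit_sphere polar_join_def power2_eq_square)
qed

lemma measurable_unit_sphere [measurable]: "Measurable.pred borel (\<lambda>\<xi>. \<xi> \<in> unit_sphere d)"
  unfolding mem_unit_sphere by measurable

lemma AE_sphere_measure: "AE \<xi> in sphere_measure d. \<xi> \<in> unit_sphere d"
proof (induction d)
  case 0
  show ?case unfolding sphere_measure.simps
    by (subst AE_distr_iff) (auto simp: AE_measure_pmf_iff mem_unit_sphere)
next
  case (Suc d)
  interpret P: pair_prob_space "polar_angle_measure d" "sphere_measure d"
    by (intro pair_prob_space.intro pair_sigma_finite.intro prob_space_imp_sigma_finite
        prob_space_polar_angle_measure prob_space_sphere_measure)
  have "AE p in polar_angle_measure d \<Otimes>\<^sub>M sphere_measure d. snd p \<in> unit_sphere d"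
    by (rule P.AE_pair_measure) (measurable, simp add: Suc)
  then have "AE p in polar_angle_measure d \<Otimes>\<^sub>M sphere_measure d.
      (case p of (\<theta>, u) \<Rightarrow> polar_join d \<theta> u) \<in> unit_sphere (Suc d)"
    by (rule eventually_mono) (auto intro: polar_join_in_sphere)
  moreover have "{\<xi> \<in> space borel. \<xi> \<in> unit_sphere (Suc d)} \<in> sets borel"
    by measurable
  ultimately show ?case unfolding sphere_measure.simps
    by (subst AE_distr_iff) auto
qed

text \<open>
  A compact set that contains the spheres of all dimensions. Every continuous function is bounded on
  it, which settles integrability once and for all.
\<close>

definition unit_cube :: "(nat \<Rightarrow> real) set"
  where "unit_cube = UNIV \<rightarrow>\<^sub>E {-1..1}"

lemma compact_unit_cube: "compact unit_cube"
proof -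
  have "compactin (product_topology (\<lambda>_::nat. euclideanreal) UNIV) unit_cube"
    unfolding unit_cube_def by (subst compactin_PiE) auto
  then show ?thesis by (simp add: euclidean_product_topology)
qed

lemma unit_sphere_subset_unit_cube: "unit_sphere d \<subseteq> unit_cube"
proof
  fix \<xi> assume "\<xi> \<in> unit_sphere d"
  then have *: "(\<Sum>i\<le>d. (\<xi> i)\<^sup>2) = 1" "\<And>i. i > d \<Longrightarrow> \<xi> i = 0"
    by (auto simp: mem_unit_sphere power2_eq_square)
  have "\<bar>\<xi> i\<bar> \<le> 1" for i
  proof (cases "i \<le> d")
    case True
    then have "(\<xi> i)\<^sup>2 \<le> (\<Sum>i\<le>d. (\<xi> i)\<^sup>2)" by (intro member_le_sum) auto
    then show ?thesis using * by (simp add: abs_square_le_1)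
  qed (use * in auto)
  then show "\<xi> \<in> unit_cube" by (auto simp: unit_cube_def abs_le_iff minus_le_iff)
qed

lemma integrable_sphere_measure:
  fixes g :: "(nat \<Rightarrow> real) \<Rightarrow> real"
  assumes "continuous_on UNIV g"
  shows "integrable (sphere_measure d) g"
proof -
  interpret prob_space "sphere_measure d" by (rule prob_space_sphere_measure)
  have "compact (g ` unit_cube)"
    using assms compact_unit_cube compact_continuous_image continuous_on_subset by blast
  then obtain B where "\<And>\<xi>. \<xi> \<in> unit_cube \<Longrightarrow> norm (g \<xi>) \<le> B"
    using compact_imp_bounded bounded_iff by (metis imageI)
  then have "AE \<xi> in sphere_measure d. norm (g \<xi>) \<le> B"
    using AE_sphere_measure unit_sphere_subset_unit_cube by (fastforce elim: eventually_mono)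
  moreover have "g \<in> borel_measurable (sphere_measure d)"
    using borel_measurable_continuous_onI[OF assms] by simp
  ultimately show ?thesis by (rule integrable_const_bound)
qed

lemma pair_prob_space_sphere_measure: "pair_prob_space (sphere_measure d) (sphere_measure d)"
  by (intro pair_prob_space.intro pair_sigma_finite.intro prob_space_imp_sigma_finite prob_space_sphere_measure)

lemma integrable_sphere_measure_pair:
  fixes g :: "(nat \<Rightarrow> real) \<times> (nat \<Rightarrow> real) \<Rightarrow> real"
  assumes "continuous_on UNIV g"
  shows "integrable (sphere_measure d \<Otimes>\<^sub>M sphere_measure d) g"
proof -
  interpret P: pair_prob_space "sphere_measure d" "sphere_measure d"
    by (rule pair_prob_space_sphere_measure)
  have "compact (g ` (unit_cube \<times> unit_cube))"
    using assms compact_Times[OF compact_unit_cube compact_unit_cube] compact_continuous_image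
      continuous_on_subset by blast
  then obtain B where B: "\<And>p. p \<in> unit_cube \<times> unit_cube \<Longrightarrow> norm (g p) \<le> B"
    using compact_imp_bounded bounded_iff by (metis imageI)
  have s: "sets (sphere_measure d \<Otimes>\<^sub>M sphere_measure d) = sets borel"
    by (subst borel_prod[symmetric]) (intro sets_pair_measure_cong, simp_all)
  have m [measurable]: "g \<in> borel_measurable (sphere_measure d \<Otimes>\<^sub>M sphere_measure d)"
    using borel_measurable_continuous_onI[OF assms] s by (simp cong: measurable_cong_sets)
  have AE: "AE \<xi> in sphere_measure d. \<xi> \<in> unit_cube"
    using AE_sphere_measure unit_sphere_subset_unit_cube by (fastforce elim: eventually_mono)
  have "AE p in sphere_measure d \<Otimes>\<^sub>M sphere_measure d. norm (g p) \<le> B"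
  proof (rule P.AE_pair_measure)
    show "AE \<xi> in sphere_measure d. AE \<eta> in sphere_measure d. norm (g (\<xi>, \<eta>)) \<le> B"
      using AE
    proof (rule eventually_mono)
      fix \<xi> assume "\<xi> \<in> unit_cube"
      then show "AE \<eta> in sphere_measure d. norm (g (\<xi>, \<eta>)) \<le> B"
        by (intro eventually_mono[OF AE]) (use B in blast)
    qed
  qed measurable
  then show ?thesis using m by (intro P.P.integrable_const_bound)
qed

lemma continuous_sphere_inner [continuous_intros]:
  assumes "continuous_on S f" "continuous_on S g"
  shows "continuous_on S (\<lambda>x. sphere_inner d (f x) (g x))"
proof -
  have "continuous_on S (\<lambda>x. f x i)" "continuous_on S (\<lambda>x. g x i)" for i
    using assms by (auto intro: continuous_on_product_then_coordinatewise)
  then show ?thesis unfolding sphere_inner_def by (intro continuous_intros)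
qed


lemma sphere_measure_Suc_integral:
  fixes g :: "(nat \<Rightarrow> real) \<Rightarrow> real"
  assumes "continuous_on UNIV g"
  shows "(\<integral>\<xi>. g \<xi> \<partial>sphere_measure (Suc d))
    = (\<integral>\<theta>. (\<integral>u. g (polar_join d \<theta> u) \<partial>sphere_measure d) \<partial>polar_angle_measure d)"
proof -
  interpret P: pair_prob_space "polar_angle_measure d" "sphere_measure d"
    by (intro pair_prob_space.intro pair_sigma_finite.intro prob_space_imp_sigma_finite
        prob_space_polar_angle_measure prob_space_sphere_measure)
  have m: "g \<in> borel_measurable borel"
    by (rule borel_measurable_continuous_onI) fact
  have "integrable (sphere_measure (Suc d)) g"
    by (rule integrable_sphere_measure) fact
  then have i: "integrable (polar_angle_measure d \<Otimes>\<^sub>M sphere_measure d) (\<lambda>p. g (case p of (\<theta>, u) \<Rightarrow> polar_join d \<theta> u))"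
    unfolding sphere_measure.simps by (subst (asm) integrable_distr_eq) (use m in measurable)
  have "(\<integral>\<xi>. g \<xi> \<partial>sphere_measure (Suc d))
      = (\<integral>p. g (case p of (\<theta>, u) \<Rightarrow> polar_join d \<theta> u) \<partial>(polar_angle_measure d \<Otimes>\<^sub>M sphere_measure d))"
    unfolding sphere_measure.simps by (subst integral_distr) (use m in measurable)
  also have "\<dots> = (\<integral>\<theta>. (\<integral>u. g (polar_join d \<theta> u) \<partial>sphere_measure d) \<partial>polar_angle_measure d)"
    using P.integral_fst'[OF i] by simp
  finally show ?thesis .
qed

lemma sum_even_reindex:
  fixes f :: "nat \<Rightarrow> real"
  shows "(\<Sum>j\<le>2 * K. if even j then f j else 0) = (\<Sum>i\<le>K. f (2 * i))"
  by (induction K) simp_all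

text \<open>
  Since \<open>(1/2)\<^sub>n = (2 n)! / (4 ^ n * n!)\<close>, the weights that the even moments attach to the even terms of
  a binomial expansion of exponent \<open>2 K\<close> turn it into one of exponent \<open>K\<close>.
\<close>

lemma choose_double_pochhammer_half:
  assumes "i \<le> K"
  shows "real (2 * K choose (2 * i)) * (pochhammer (1/2) (K - i) * pochhammer (1/2) i)
    = real (K choose i) * pochhammer (1/2) K"
proof -
  have h: "pochhammer (1/2) n = fact (2 * n) / (2 ^ (2 * n) * fact n :: real)" for n
    by (simp add: fact_double)
  have "2 * K - 2 * i = 2 * (K - i)" by simp
  then have c: "real (2 * K choose (2 * i)) = fact (2 * K) / (fact (2 * i) * fact (2 * (K - i)))"
    using assms by (subst binomial_fact) auto
  have d: "real (K choose i) = fact K / (fact i * fact (K - i))"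
    using assms by (rule binomial_fact)
  have p: "(2::real) ^ (2 * K) = 2 ^ (2 * (K - i)) * 2 ^ (2 * i)"
    using assms by (simp flip: power_add)
  show ?thesis unfolding h c d p by simp
qed

text \<open>
  This replaces rotation invariance: the moment depends on \<open>\<eta>\<close> only through its norm. In polar
  coordinates the inner product is a sum of two terms; expand its power, use the moments of the lower
  sphere and of the angle, and the even terms recombine into \<open>(r + y\<^sup>2) ^ K\<close>, where \<open>y\<close> is the last
  coordinate of \<open>\<eta>\<close> and \<open>r\<close> the squared norm of the others.
\<close>

lemma sphere_inner_moment:
  "(\<integral>\<xi>. sphere_inner d \<xi> \<eta> ^ k \<partial>sphere_measure d)
    = (if even k then pochhammer (1/2) (k div 2) / pochhammer ((real d + 1) / 2) (k div 2)
          * sphere_inner d \<eta> \<eta> ^ (k div 2) else 0)"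
proof (induction d arbitrary: k)
  case 0
  have "(\<integral>\<xi>. sphere_inner 0 \<xi> \<eta> ^ k \<partial>sphere_measure 0) = ((- \<eta> 0) ^ k + \<eta> 0 ^ k) / 2"
    unfolding sphere_measure.simps
    by (subst integral_distr)
       (auto simp: integral_pmf_of_set sphere_inner_def
         intro!: borel_measurable_continuous_onI continuous_intros continuous_on_product_coordinates)
  moreover have "pochhammer (1/2) n \<noteq> (0::real)" for n
    using pochhammer_pos[of "1/2::real" n] by simp
  ultimately show ?case
    by (auto simp: sphere_inner_def power_mult_distrib elim!: evenE simp flip: power2_eq_square power_mult)
next
  case (Suc d)
  define y where "y = \<eta> (Suc d)"
  define r where "r = sphere_inner d \<eta> \<eta>"
  define M where "M j = (\<integral>u. sphere_inner d u \<eta> ^ j \<partial>sphere_measure d)" for j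
  have split: "sphere_inner (Suc d) \<eta> \<eta> = r + y\<^sup>2"
    by (simp add: sphere_inner_def r_def y_def power2_eq_square)
  have "(\<integral>\<xi>. sphere_inner (Suc d) \<xi> \<eta> ^ k \<partial>sphere_measure (Suc d))
     = (\<integral>\<theta>. (\<integral>u. (sin \<theta> * sphere_inner d u \<eta> + cos \<theta> * y) ^ k \<partial>sphere_measure d) \<partial>polar_angle_measure d)"
    by (subst sphere_measure_Suc_integral)
       (auto intro!: continuous_intros simp: sphere_inner_polar_join y_def)
  also have "(\<lambda>\<theta>. \<integral>u. (sin \<theta> * sphere_inner d u \<eta> + cos \<theta> * y) ^ k \<partial>sphere_measure d)
      = (\<lambda>\<theta>. \<Sum>j\<le>k. real (k choose j) * M j * y ^ (k - j) * (sin \<theta> ^ j * cos \<theta> ^ (k - j)))"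
  proof
    fix \<theta>
    have "(\<integral>u. (sin \<theta> * sphere_inner d u \<eta> + cos \<theta> * y) ^ k \<partial>sphere_measure d)
       = (\<integral>u. (\<Sum>j\<le>k. real (k choose j) * y ^ (k - j) * (sin \<theta> ^ j * cos \<theta> ^ (k - j)) * sphere_inner d u \<eta> ^ j) \<partial>sphere_measure d)"
      by (simp add: binomial_ring power_mult_distrib mult_ac)
    also have "\<dots> = (\<Sum>j\<le>k. real (k choose j) * y ^ (k - j) * (sin \<theta> ^ j * cos \<theta> ^ (k - j)) * M j)"
      unfolding M_def
      by (subst Bochner_Integration.integral_sum)
         (auto intro!: integrable_sphere_measure continuous_intros)
    finally show "(\<integral>u. (sin \<theta> * sphere_inner d u \<eta> + cos \<theta> * y) ^ k \<partial>sphere_measure d)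
        = (\<Sum>j\<le>k. real (k choose j) * M j * y ^ (k - j) * (sin \<theta> ^ j * cos \<theta> ^ (k - j)))"
      by (simp add: mult_ac)
  qed
  also have "(\<integral>\<theta>. (\<Sum>j\<le>k. real (k choose j) * M j * y ^ (k - j) * (sin \<theta> ^ j * cos \<theta> ^ (k - j))) \<partial>polar_angle_measure d)
      = (\<Sum>j\<le>k. real (k choose j) * M j * y ^ (k - j) * (\<integral>\<theta>. sin \<theta> ^ j * cos \<theta> ^ (k - j) \<partial>polar_angle_measure d))"
    by (subst Bochner_Integration.integral_sum)
       (auto intro!: polar_angle_integral(1) continuous_intros)
  finally have main: "(\<integral>\<xi>. sphere_inner (Suc d) \<xi> \<eta> ^ k \<partial>sphere_measure (Suc d)) = \<dots>" .
  have even_j: "(\<integral>\<theta>. sin \<theta> ^ (2 * i) * cos \<theta> ^ l \<partial>polar_angle_measure d)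
      = zonal_mean d (\<lambda>x. x ^ l * (1 - x\<^sup>2) ^ i)" for i l
  proof -
    have "sin \<theta> ^ (2 * i) = (1 - (cos \<theta>)\<^sup>2) ^ i" for \<theta> :: real
      by (simp only: power_mult sin_squared_eq)
    then show ?thesis
      by (subst polar_angle_integral_cos[symmetric]) (auto intro!: continuous_intros simp: mult.commute)
  qed
  show ?case
  proof (cases "even k")
    case True
    then obtain K where k: "k = 2 * K" by (elim evenE)
    have "(\<integral>\<xi>. sphere_inner (Suc d) \<xi> \<eta> ^ k \<partial>sphere_measure (Suc d))
       = (\<Sum>j\<le>2 * K. if even j then real (k choose j) * M j * y ^ (k - j) * (\<integral>\<theta>. sin \<theta> ^ j * cos \<theta> ^ (k - j) \<partial>polar_angle_measure d) else 0)"
      unfolding main by (intro sum.cong) (auto simp: k M_def Suc)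
    also have "\<dots> = (\<Sum>i\<le>K. real (2 * K choose (2 * i)) * M (2 * i) * y ^ (2 * (K - i)) * zonal_mean d (\<lambda>x. x ^ (2 * (K - i)) * (1 - x\<^sup>2) ^ i))"
      by (simp add: sum_even_reindex k even_j diff_mult_distrib2)
    also have "\<dots> = (\<Sum>i\<le>K. pochhammer (1/2) K / pochhammer ((real (Suc d) + 1) / 2) K * (real (K choose i) * r ^ i * (y\<^sup>2) ^ (K - i)))"
    proof (intro sum.cong refl)
      fix i assume "i \<in> {..K}"
      then have i: "i \<le> K" by simp
      let ?Q = "pochhammer ((real d + 1) / 2) i" and ?R = "pochhammer ((real (Suc d) + 1) / 2) K"
      have Q: "?Q \<noteq> 0" using pochhammer_pos[of "(real d + 1) / 2" i] by simp
      have M: "M (2 * i) = pochhammer (1/2) i / ?Q * r ^ i"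
        by (simp add: M_def Suc r_def)
      have z: "zonal_mean d (\<lambda>x. x ^ (2 * (K - i)) * (1 - x\<^sup>2) ^ i) = pochhammer (1/2) (K - i) * ?Q / ?R"
        using i by (simp add: zonal_mean_even_moment add.commute)
      have "real (2 * K choose (2 * i)) * M (2 * i) * y ^ (2 * (K - i)) * zonal_mean d (\<lambda>x. x ^ (2 * (K - i)) * (1 - x\<^sup>2) ^ i)
        = (real (2 * K choose (2 * i)) * (pochhammer (1/2) (K - i) * pochhammer (1/2) i)) / ?R * (r ^ i * (y\<^sup>2) ^ (K - i))"
        unfolding M z using Q by (simp add: power_mult)
      also have "\<dots> = pochhammer (1/2) K / ?R * (real (K choose i) * r ^ i * (y\<^sup>2) ^ (K - i))"
        unfolding choose_double_pochhammer_half[OF i] by simp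
      finally show "real (2 * K choose (2 * i)) * M (2 * i) * y ^ (2 * (K - i)) * zonal_mean d (\<lambda>x. x ^ (2 * (K - i)) * (1 - x\<^sup>2) ^ i)
        = pochhammer (1/2) K / ?R * (real (K choose i) * r ^ i * (y\<^sup>2) ^ (K - i))" .
    qed
    also have "\<dots> = pochhammer (1/2) K / pochhammer ((real (Suc d) + 1) / 2) K * (r + y\<^sup>2) ^ K"
      by (subst binomial_ring) (simp add: sum_distrib_left)
    finally show ?thesis using k split by simp
  next
    case False
    have "real (k choose j) * M j * y ^ (k - j) * (\<integral>\<theta>. sin \<theta> ^ j * cos \<theta> ^ (k - j) \<partial>polar_angle_measure d) = 0"
      if "j \<le> k" for j
    proof (cases "even j")
      case True
      then obtain i where j: "j = 2 * i" by (elim evenE)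
      have "odd (k - j)" using that False True by simp
      then obtain a where "k - j = 2 * a + 1" by (elim oddE)
      then have "(\<integral>\<theta>. sin \<theta> ^ j * cos \<theta> ^ (k - j) \<partial>polar_angle_measure d) = 0"
        unfolding j by (simp only: even_j zonal_mean_odd_moment)
      then show ?thesis by simp
    qed (simp add: M_def Suc)
    then show ?thesis unfolding main using False by (simp add: sum.neutral)
  qed
qed

section \<open>The Funk--Hecke formula\<close>

(* Integrals over higher spheres are reduced by the moment formula, not by unfolding. *)
declare sphere_measure.simps(2) [simp del]

text \<open>
  Each factor contributes at most one \<open>x\<close> for every \<open>s\<close> in the expansion of \<open>(1 + 2 x s + s\<^sup>2) ^ K\<close>.
\<close>

lemma coeff_quadratic_power_is_poly:
  "\<exists>A. degree A \<le> a \<and> (\<forall>x::real. coeff ([:1, 2 * x, 1:] ^ K) a = poly A x)"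
proof (induction K arbitrary: a)
  case 0
  show ?case by (rule exI[of _ "if a = 0 then 1 else 0"]) auto
next
  case (Suc K)
  obtain A where A: "\<And>a. degree (A a) \<le> a" "\<And>a (x::real). coeff ([:1, 2 * x, 1:] ^ K) a = poly (A a) x"
    using Suc by metis
  consider "a = 0" | "a = Suc 0" | b where "a = Suc (Suc b)"
    by (metis not0_implies_Suc)
  then show ?case
  proof cases
    case 1
    then show ?thesis using A(1)[of 0] A(2) by (intro exI[of _ "A 0"]) auto
  next
    case 2
    have "degree (A 1 + [:0, 2:] * A 0) \<le> 1"
      by (intro degree_add_le) (use A(1)[of 1] A(1)[of 0] degree_mult_le[of "[:0, 2:]" "A 0"] in auto)
    then show ?thesis using 2 A by (intro exI[of _ "A 1 + [:0, 2:] * A 0"]) auto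
  next
    case 3
    have "degree (A a + [:0, 2:] * A (Suc b) + A b) \<le> a"
      by (intro degree_add_le)
         (use 3 A(1)[of a] A(1)[of b] A(1)[of "Suc b"] degree_mult_le[of "[:0, 2:]" "A (Suc b)"] in auto)
    then show ?thesis using 3 A by (intro exI[of _ "A a + [:0, 2:] * A (Suc b) + A b"]) auto
  qed
qed

lemma continuous_poly_sphere_inner [continuous_intros]:
  assumes "continuous_on S f" "continuous_on S g"
  shows "continuous_on S (\<lambda>x. poly p (sphere_inner d (f x) (g x)))"
  by (intro continuous_intros assms)

text \<open>
  Polarisation: the moment of order \<open>a + b\<close> in the direction \<open>s * \<xi> + \<eta>\<close> is a constant times a power of
  \<open>\<parallel>s * \<xi> + \<eta>\<parallel>\<^sup>2 = s\<^sup>2 + 2 * s * \<langle>\<xi>, \<eta>\<rangle> + 1\<close>, and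
  the coefficient of \<open>s ^ a\<close> in it is the mixed moment, up to a binomial coefficient. Odd orders give zero.
\<close>

lemma two_point_moment_left:
  "\<exists>A. degree A \<le> a \<and> (\<forall>\<xi>\<in>unit_sphere d. \<forall>\<eta>\<in>unit_sphere d.
     (\<integral>\<zeta>. sphere_inner d \<xi> \<zeta> ^ a * sphere_inner d \<zeta> \<eta> ^ b \<partial>sphere_measure d) = poly A (sphere_inner d \<xi> \<eta>))"
proof -
  define k where "k = a + b"
  define K where "K = k div 2"
  define c where "c = (if even k then pochhammer (1/2) K / pochhammer ((real d + 1) / 2) K else 0)"
  obtain A where A: "degree A \<le> a" "\<And>x::real. coeff ([:1, 2 * x, 1:] ^ K) a = poly A x"
    using coeff_quadratic_power_is_poly by metis
  show ?thesis
  proof (intro exI[of _ "smult (c / real (k choose a)) A"] conjI ballI)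
    show "degree (smult (c / real (k choose a)) A) \<le> a"
      using A(1) degree_smult_le order_trans by blast
    fix \<xi> \<eta> assume \<xi>: "\<xi> \<in> unit_sphere d" and \<eta>: "\<eta> \<in> unit_sphere d"
    define x where "x = sphere_inner d \<xi> \<eta>"
    define M where "M i = (\<integral>\<zeta>. sphere_inner d \<xi> \<zeta> ^ i * sphere_inner d \<zeta> \<eta> ^ (k - i) \<partial>sphere_measure d)" for i
    have "poly (\<Sum>i\<le>k. monom (real (k choose i) * M i) i) s = poly (smult c ([:1, 2 * x, 1:] ^ K)) s" for s
    proof -
      define v where "v = (\<lambda>i. s * \<xi> i + \<eta> i)"
      have lin: "sphere_inner d \<zeta> v = s * sphere_inner d \<xi> \<zeta> + sphere_inner d \<zeta> \<eta>" for \<zeta>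
        by (simp add: v_def sphere_inner_def sum_distrib_left algebra_simps sum.distrib)
      have "sphere_inner d v v = s\<^sup>2 * sphere_inner d \<xi> \<xi> + 2 * s * x + sphere_inner d \<eta> \<eta>"
        by (simp add: v_def sphere_inner_def x_def sum_distrib_left algebra_simps sum.distrib power2_eq_square)
      then have vv: "sphere_inner d v v = poly [:1, 2 * x, 1:] s"
        by (simp add: sphere_inner_self \<xi> \<eta> power2_eq_square algebra_simps)
      have "(\<integral>\<zeta>. sphere_inner d \<zeta> v ^ k \<partial>sphere_measure d) = c * poly [:1, 2 * x, 1:] s ^ K"
        by (simp add: sphere_inner_moment c_def K_def vv)
      moreover have "(\<integral>\<zeta>. sphere_inner d \<zeta> v ^ k \<partial>sphere_measure d)
          = (\<integral>\<zeta>. (\<Sum>i\<le>k. real (k choose i) * s ^ i * (sphere_inner d \<xi> \<zeta> ^ i * sphere_inner d \<zeta> \<eta> ^ (k - i))) \<partial>sphere_measure d)"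
        by (simp add: lin binomial_ring power_mult_distrib mult_ac)
      moreover have "\<dots> = (\<Sum>i\<le>k. real (k choose i) * s ^ i * M i)"
        unfolding M_def
        by (subst Bochner_Integration.integral_sum)
           (auto intro!: integrable_sphere_measure continuous_intros)
      ultimately show ?thesis
        by (simp add: poly_sum poly_monom mult_ac)
    qed
    then have "(\<Sum>i\<le>k. monom (real (k choose i) * M i) i) = smult c ([:1, 2 * x, 1:] ^ K)"
      by (intro poly_eq_poly_eq_iff[THEN iffD1]) auto
    then have "coeff (\<Sum>i\<le>k. monom (real (k choose i) * M i) i) a = c * poly A x"
      by (simp add: A)
    moreover have "coeff (\<Sum>i\<le>k. monom (real (k choose i) * M i) i) a = real (k choose a) * M a"
      by (simp add: coeff_sum k_def)
    ultimately have "M a = c / real (k choose a) * poly A x"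
      by (simp add: k_def field_simps)
    then show "(\<integral>\<zeta>. sphere_inner d \<xi> \<zeta> ^ a * sphere_inner d \<zeta> \<eta> ^ b \<partial>sphere_measure d)
        = poly (smult (c / real (k choose a)) A) (sphere_inner d \<xi> \<eta>)"
      by (simp add: M_def k_def x_def)
  qed
qed

text \<open>
  Exchanging the two points exchanges \<open>a\<close> and \<open>b\<close>, so the degree is bounded by the second exponent as
  well. This is the bound that the Funk--Hecke formula needs: convolution does not raise the degree of
  its second factor.
\<close>

lemma two_point_moment:
  "\<exists>A. degree A \<le> b \<and> (\<forall>\<xi>\<in>unit_sphere d. \<forall>\<eta>\<in>unit_sphere d.
     (\<integral>\<zeta>. sphere_inner d \<xi> \<zeta> ^ a * sphere_inner d \<zeta> \<eta> ^ b \<partial>sphere_measure d) = poly A (sphere_inner d \<xi> \<eta>))"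
proof -
  have swap: "(\<integral>\<zeta>. sphere_inner d \<xi> \<zeta> ^ a * sphere_inner d \<zeta> \<eta> ^ b \<partial>sphere_measure d)
      = (\<integral>\<zeta>. sphere_inner d \<eta> \<zeta> ^ b * sphere_inner d \<zeta> \<xi> ^ a \<partial>sphere_measure d)" for \<xi> \<eta>
    by (intro Bochner_Integration.integral_cong refl)
       (simp add: mult.commute sphere_inner_commute[of d _ \<xi>] sphere_inner_commute[of d _ \<eta>])
  obtain A where "degree A \<le> b" and A: "\<forall>\<xi>\<in>unit_sphere d. \<forall>\<eta>\<in>unit_sphere d.
     (\<integral>\<zeta>. sphere_inner d \<xi> \<zeta> ^ b * sphere_inner d \<zeta> \<eta> ^ a \<partial>sphere_measure d) = poly A (sphere_inner d \<xi> \<eta>)"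
    using two_point_moment_left[of b d a] by blast
  moreover have "(\<integral>\<zeta>. sphere_inner d \<xi> \<zeta> ^ a * sphere_inner d \<zeta> \<eta> ^ b \<partial>sphere_measure d) = poly A (sphere_inner d \<xi> \<eta>)"
    if "\<xi> \<in> unit_sphere d" "\<eta> \<in> unit_sphere d" for \<xi> \<eta>
    unfolding swap sphere_inner_commute[of d \<xi> \<eta>] using A that by blast
  ultimately show ?thesis by blast
qed

lemma zonal_convolution_poly:
  "\<exists>R. degree R \<le> degree r \<and> (\<forall>\<xi>\<in>unit_sphere d. \<forall>\<eta>\<in>unit_sphere d.
     (\<integral>\<zeta>. poly p (sphere_inner d \<xi> \<zeta>) * poly r (sphere_inner d \<zeta> \<eta>) \<partial>sphere_measure d) = poly R (sphere_inner d \<xi> \<eta>))"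
proof -
  obtain A where A: "\<And>a b. degree (A a b) \<le> b" "\<And>a b \<xi> \<eta>. \<xi> \<in> unit_sphere d \<Longrightarrow> \<eta> \<in> unit_sphere d \<Longrightarrow>
     (\<integral>\<zeta>. sphere_inner d \<xi> \<zeta> ^ a * sphere_inner d \<zeta> \<eta> ^ b \<partial>sphere_measure d) = poly (A a b) (sphere_inner d \<xi> \<eta>)"
  proof -
    have "\<forall>a b. \<exists>A. degree A \<le> b \<and> (\<forall>\<xi>\<in>unit_sphere d. \<forall>\<eta>\<in>unit_sphere d.
     (\<integral>\<zeta>. sphere_inner d \<xi> \<zeta> ^ a * sphere_inner d \<zeta> \<eta> ^ b \<partial>sphere_measure d) = poly A (sphere_inner d \<xi> \<eta>))"
      by (intro allI two_point_moment)
    then show ?thesis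
      using that unfolding choice_iff by blast
  qed
  define R where "R = (\<Sum>a\<le>degree p. \<Sum>b\<le>degree r. smult (coeff p a * coeff r b) (A a b))"
  show ?thesis
  proof (intro exI[of _ R] conjI ballI)
    show "degree R \<le> degree r"
    proof -
      have "degree (smult c (A a b)) \<le> degree r" if "b \<in> {..degree r}" for a b c
        using degree_smult_le[of c "A a b"] A(1)[of a b] that by simp
      then show ?thesis
        unfolding R_def by (intro degree_sum_le finite_atMost)
    qed
    fix \<xi> \<eta> assume s: "\<xi> \<in> unit_sphere d" "\<eta> \<in> unit_sphere d"
    have "(\<integral>\<zeta>. poly p (sphere_inner d \<xi> \<zeta>) * poly r (sphere_inner d \<zeta> \<eta>) \<partial>sphere_measure d)
       = (\<integral>\<zeta>. (\<Sum>a\<le>degree p. \<Sum>b\<le>degree r. (coeff p a * coeff r b) * (sphere_inner d \<xi> \<zeta> ^ a * sphere_inner d \<zeta> \<eta> ^ b)) \<partial>sphere_measure d)"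
    proof -
      have "poly p x * poly r y = (\<Sum>a\<le>degree p. \<Sum>b\<le>degree r. (coeff p a * coeff r b) * (x ^ a * y ^ b))" for x y
        unfolding poly_altdef sum_product by (intro sum.cong refl) simp
      then show ?thesis by simp
    qed
    also have "\<dots> = (\<Sum>a\<le>degree p. \<Sum>b\<le>degree r. (coeff p a * coeff r b) * (\<integral>\<zeta>. sphere_inner d \<xi> \<zeta> ^ a * sphere_inner d \<zeta> \<eta> ^ b \<partial>sphere_measure d))"
    proof -
      have int: "integrable (sphere_measure d) (\<lambda>\<zeta>. (coeff p a * coeff r b) * (sphere_inner d \<xi> \<zeta> ^ a * sphere_inner d \<zeta> \<eta> ^ b))" for a b
        by (intro integrable_sphere_measure continuous_intros)
      show ?thesis
        by (subst Bochner_Integration.integral_sum, intro Bochner_Integration.integrable_sum int,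
            intro sum.cong refl, subst Bochner_Integration.integral_sum, rule int, simp)
    qed
    also have "\<dots> = poly R (sphere_inner d \<xi> \<eta>)"
      by (simp add: R_def poly_sum A(2) s)
    finally show "(\<integral>\<zeta>. poly p (sphere_inner d \<xi> \<zeta>) * poly r (sphere_inner d \<zeta> \<eta>) \<partial>sphere_measure d)
       = poly R (sphere_inner d \<xi> \<eta>)" .
  qed
qed

lemma sphere_integral_zonal_poly:
  assumes \<eta>: "\<eta> \<in> unit_sphere (Suc e)"
  shows "(\<integral>\<xi>. poly p (sphere_inner (Suc e) \<xi> \<eta>) \<partial>sphere_measure (Suc e)) = zonal_mean e (poly p)"
proof -
  have mom: "(\<integral>\<xi>. sphere_inner (Suc e) \<xi> \<eta> ^ k \<partial>sphere_measure (Suc e)) = zonal_mean e (\<lambda>x. x ^ k)" for k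
  proof (cases "even k")
    case True
    then show ?thesis
      using zonal_mean_even_moment[of e "k div 2" 0]
      by (simp add: sphere_inner_moment sphere_inner_self[OF \<eta>] add.commute)
  next
    case False
    then show ?thesis
      using zonal_mean_odd_moment[of e "k div 2" 0] by (simp add: sphere_inner_moment)
  qed
  have "(\<integral>\<xi>. poly p (sphere_inner (Suc e) \<xi> \<eta>) \<partial>sphere_measure (Suc e))
      = (\<Sum>k\<le>degree p. coeff p k * (\<integral>\<xi>. sphere_inner (Suc e) \<xi> \<eta> ^ k \<partial>sphere_measure (Suc e)))"
    unfolding poly_altdef
    by (subst Bochner_Integration.integral_sum)
       (auto simp del: sphere_measure.simps intro!: integrable_sphere_measure continuous_intros)
  also have "\<dots> = zonal_mean e (\<lambda>x. \<Sum>k\<le>degree p. coeff p k * x ^ k)"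
    by (subst zonal_mean_sum) (auto simp: mom zonal_mean_cmult intro!: continuous_intros)
  also have "\<dots> = zonal_mean e (poly p)"
    by (rule zonal_mean_cong) (simp add: poly_altdef)
  finally show ?thesis .
qed

lemma zonal_mean_poly_mult:
  "zonal_mean e (poly (p * q)) = zonal_mean e (\<lambda>x. poly p x * poly q x)"
  by (rule zonal_mean_cong) simp

lemma measurable_sphere_integral:
  fixes f :: "(nat \<Rightarrow> real) \<Rightarrow> (nat \<Rightarrow> real) \<Rightarrow> real"
  assumes "continuous_on UNIV (\<lambda>p. f (fst p) (snd p))"
  shows "(\<lambda>\<xi>. \<integral>\<zeta>. f \<xi> \<zeta> \<partial>sphere_measure d) \<in> borel_measurable (sphere_measure d)"
proof -
  interpret P: pair_prob_space "sphere_measure d" "sphere_measure d"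
    by (rule pair_prob_space_sphere_measure)
  have "integrable (sphere_measure d \<Otimes>\<^sub>M sphere_measure d) (\<lambda>p. f (fst p) (snd p))"
    by (rule integrable_sphere_measure_pair) fact
  from P.integrable_fst'[OF this] show ?thesis by simp
qed

lemma sphere_integral_swap:
  fixes f :: "(nat \<Rightarrow> real) \<Rightarrow> (nat \<Rightarrow> real) \<Rightarrow> real"
  assumes "continuous_on UNIV (\<lambda>p. f (fst p) (snd p))"
  shows "(\<integral>\<xi>. (\<integral>\<zeta>. f \<xi> \<zeta> \<partial>sphere_measure d) \<partial>sphere_measure d)
    = (\<integral>\<zeta>. (\<integral>\<xi>. f \<xi> \<zeta> \<partial>sphere_measure d) \<partial>sphere_measure d)"
proof -
  interpret P: pair_prob_space "sphere_measure d" "sphere_measure d"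
    by (rule pair_prob_space_sphere_measure)
  have "integrable (sphere_measure d \<Otimes>\<^sub>M sphere_measure d) (\<lambda>(x, y). f x y)"
    using integrable_sphere_measure_pair[OF assms] by (simp add: case_prod_beta')
  from P.Fubini_integral[OF this] show ?thesis by simp
qed

lemma sphere_integral_cong:
  assumes "\<And>\<xi>. \<xi> \<in> unit_sphere d \<Longrightarrow> g \<xi> = h \<xi>"
    and "g \<in> borel_measurable (sphere_measure d)" "h \<in> borel_measurable (sphere_measure d)"
  shows "(\<integral>\<xi>. g \<xi> \<partial>sphere_measure d) = (\<integral>\<xi>. h \<xi> \<partial>sphere_measure d)"
  using AE_sphere_measure[of d] assms
  by (intro integral_cong_AE) (auto elim!: eventually_mono)

lemma measurable_sphere_continuous:
  fixes g :: "(nat \<Rightarrow> real) \<Rightarrow> real"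
  assumes "continuous_on UNIV g"
  shows "g \<in> borel_measurable (sphere_measure d)"
  using borel_measurable_continuous_onI[OF assms] by simp

lemma unit_sphere_nonempty: "\<exists>\<eta>. \<eta> \<in> unit_sphere d"
  using in_topspace_nsphere by blast

text \<open>
  Let \<open>R\<close> be the zonal polynomial that the convolution defines; its degree is at most \<open>n\<close>. To test \<open>R\<close>
  against \<open>r\<close> of degree less than \<open>n\<close>, exchange the integrals: the convolution of \<open>p\<close> with \<open>r\<close> still has
  degree less than \<open>n\<close>, so it is orthogonal to the Gegenbauer polynomial. By uniqueness \<open>R\<close> is a
  multiple of that polynomial, with a factor found by setting \<open>\<xi> = \<eta>\<close>.
\<close>

lemma funk_hecke_poly:
  assumes s: "\<xi> \<in> unit_sphere (Suc e)" "\<eta> \<in> unit_sphere (Suc e)"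
  shows "(\<integral>\<zeta>. poly p (sphere_inner (Suc e) \<xi> \<zeta>) * poly (gegenbauer n e) (sphere_inner (Suc e) \<zeta> \<eta>) \<partial>sphere_measure (Suc e))
    = zonal_mean e (\<lambda>x. poly p x * poly (gegenbauer n e) x) / poly (gegenbauer n e) 1
      * poly (gegenbauer n e) (sphere_inner (Suc e) \<xi> \<eta>)"
proof -
  define d where "d = Suc e"
  define q where "q = gegenbauer n e"
  note s = s[folded d_def]
  note zp = sphere_integral_zonal_poly[of _ e, folded d_def]
  obtain R where dR: "degree R \<le> degree q" and R: "\<And>\<xi> \<eta>. \<xi> \<in> unit_sphere d \<Longrightarrow> \<eta> \<in> unit_sphere d \<Longrightarrow>
      (\<integral>\<zeta>. poly p (sphere_inner d \<xi> \<zeta>) * poly q (sphere_inner d \<zeta> \<eta>) \<partial>sphere_measure d) = poly R (sphere_inner d \<xi> \<eta>)"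
    using zonal_convolution_poly[of q d p] by blast
  obtain \<eta>0 where \<eta>0: "\<eta>0 \<in> unit_sphere d" using unit_sphere_nonempty by blast
  have orth: "zonal_mean e (\<lambda>x. poly r x * poly R x) = 0" if "degree r < n" for r
  proof -
    obtain R' where dR': "degree R' \<le> degree r" and R': "\<And>\<xi> \<eta>. \<xi> \<in> unit_sphere d \<Longrightarrow> \<eta> \<in> unit_sphere d \<Longrightarrow>
      (\<integral>\<zeta>. poly p (sphere_inner d \<xi> \<zeta>) * poly r (sphere_inner d \<zeta> \<eta>) \<partial>sphere_measure d) = poly R' (sphere_inner d \<xi> \<eta>)"
      using zonal_convolution_poly[of r d p] by blast
    define f where "f \<xi> \<zeta> = poly r (sphere_inner d \<xi> \<eta>0) * (poly p (sphere_inner d \<xi> \<zeta>) * poly q (sphere_inner d \<zeta> \<eta>0))" for \<xi> \<zeta>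
    have cf: "continuous_on UNIV (\<lambda>p. f (fst p) (snd p))"
      and cf': "continuous_on UNIV (\<lambda>p. f (snd p) (fst p))"
      unfolding f_def by (intro continuous_intros)+
    have "zonal_mean e (poly (r * R)) = (\<integral>\<xi>. poly (r * R) (sphere_inner d \<xi> \<eta>0) \<partial>sphere_measure d)"
      by (rule zp[OF \<eta>0, symmetric])
    also have "\<dots> = (\<integral>\<xi>. (\<integral>\<zeta>. f \<xi> \<zeta> \<partial>sphere_measure d) \<partial>sphere_measure d)"
    proof (rule sphere_integral_cong)
      show "poly (r * R) (sphere_inner d \<xi> \<eta>0) = (\<integral>\<zeta>. f \<xi> \<zeta> \<partial>sphere_measure d)"
        if "\<xi> \<in> unit_sphere d" for \<xi>
        by (simp add: f_def R[OF that \<eta>0])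
    qed (auto intro!: measurable_sphere_integral[OF cf] measurable_sphere_continuous continuous_intros)
    also have "\<dots> = (\<integral>\<zeta>. (\<integral>\<xi>. f \<xi> \<zeta> \<partial>sphere_measure d) \<partial>sphere_measure d)"
      by (rule sphere_integral_swap[OF cf])
    also have "\<dots> = (\<integral>\<zeta>. poly (R' * q) (sphere_inner d \<zeta> \<eta>0) \<partial>sphere_measure d)"
    proof (rule sphere_integral_cong)
      fix \<zeta> assume \<zeta>: "\<zeta> \<in> unit_sphere d"
      have "(\<integral>\<xi>. f \<xi> \<zeta> \<partial>sphere_measure d) = poly q (sphere_inner d \<zeta> \<eta>0) *
          (\<integral>\<xi>. poly p (sphere_inner d \<zeta> \<xi>) * poly r (sphere_inner d \<xi> \<eta>0) \<partial>sphere_measure d)"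
        by (subst integral_mult_right_zero[symmetric]) (simp add: f_def mult_ac sphere_inner_commute[of d \<zeta>])
      then show "(\<integral>\<xi>. f \<xi> \<zeta> \<partial>sphere_measure d) = poly (R' * q) (sphere_inner d \<zeta> \<eta>0)"
        by (simp add: R'[OF \<zeta> \<eta>0])
    qed (auto intro!: measurable_sphere_continuous continuous_intros measurable_sphere_integral[OF cf'])
    also have "\<dots> = zonal_mean e (poly (R' * q))" by (rule zp[OF \<eta>0])
    also have "\<dots> = 0"
      using gegenbauer_orthogonal[of R' n e] dR' that by (simp add: q_def zonal_mean_poly_mult)
    finally show ?thesis by (simp add: zonal_mean_poly_mult)
  qed
  have "degree R \<le> n" using dR degree_gegenbauer_le[of n e] by (simp add: q_def)
  then have Rq: "R = smult (poly R 1 / poly q 1) q"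
    unfolding q_def by (rule gegenbauer_unique) (rule orth)
  have "poly p (sphere_inner d \<eta>0 \<zeta>) * poly q (sphere_inner d \<zeta> \<eta>0) = poly (p * q) (sphere_inner d \<zeta> \<eta>0)" for \<zeta>
    using sphere_inner_commute[of d \<eta>0 \<zeta>] by simp
  then have "poly R 1 = zonal_mean e (poly (p * q))"
    using R[OF \<eta>0 \<eta>0] zp[OF \<eta>0, of "p * q"] by (simp only: sphere_inner_self[OF \<eta>0])
  then have "poly R (sphere_inner d \<xi> \<eta>)
      = zonal_mean e (poly (p * q)) / poly q 1 * poly q (sphere_inner d \<xi> \<eta>)"
    by (subst Rq) simp
  then show ?thesis
    using R[OF s] by (simp add: d_def q_def zonal_mean_poly_mult)
qed

lemma polynomial_approximation:
  assumes "continuous_on {-1..1} F" "\<epsilon> > (0::real)"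
  shows "\<exists>p. \<forall>x\<in>{-1..1}. \<bar>F x - poly p x\<bar> < \<epsilon>"
proof -
  obtain g where g: "real_polynomial_function g" "\<And>x. x \<in> {-1..1} \<Longrightarrow> \<bar>F x - g x\<bar> < \<epsilon>"
    using Stone_Weierstrass_real_polynomial_function[OF compact_Icc assms] by blast
  then obtain a n where "g = (\<lambda>x. \<Sum>i\<le>n. a i * x ^ i)"
    by (auto simp: real_polynomial_function_iff_sum)
  then have "g = poly (\<Sum>i\<le>n. monom (a i) i)"
    by (auto simp: fun_eq_iff poly_sum poly_monom)
  then show ?thesis using g by blast
qed

lemma sphere_inner_in_Icc:
  assumes "\<xi> \<in> unit_sphere d" "\<eta> \<in> unit_sphere d"
  shows "sphere_inner d \<xi> \<eta> \<in> {-1..1}"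
  by (simp flip: cos_geodesic_dist[OF assms])

lemma sphere_integral_bound:
  fixes g :: "(nat \<Rightarrow> real) \<Rightarrow> real"
  assumes "continuous_on UNIV g" "\<And>\<xi>. \<xi> \<in> unit_sphere d \<Longrightarrow> \<bar>g \<xi>\<bar> \<le> B"
  shows "\<bar>\<integral>\<xi>. g \<xi> \<partial>sphere_measure d\<bar> \<le> B"
proof -
  interpret prob_space "sphere_measure d" by (rule prob_space_sphere_measure)
  have b: "g \<xi> \<le> B" "- B \<le> g \<xi>" if "\<xi> \<in> unit_sphere d" for \<xi>
    using assms(2)[OF that] by arith+
  have "AE \<xi> in sphere_measure d. g \<xi> \<le> B" "AE \<xi> in sphere_measure d. - B \<le> g \<xi>"
    by (rule eventually_mono[OF AE_sphere_measure], rule b, assumption)+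
  then have "(\<integral>\<xi>. g \<xi> \<partial>sphere_measure d) \<le> B" "- B \<le> (\<integral>\<xi>. g \<xi> \<partial>sphere_measure d)"
    using integral_le_const[of g B] integral_ge_const[of g "- B"] integrable_sphere_measure[OF assms(1)] by auto
  then show ?thesis by (simp add: abs_le_iff)
qed

lemma zonal_mean_bound:
  assumes "continuous_on {-1..1} F" "\<And>x. x \<in> {-1..1} \<Longrightarrow> \<bar>F x\<bar> \<le> B"
  shows "\<bar>zonal_mean e F\<bar> \<le> B"
proof -
  have b: "F x \<le> B" "- B \<le> F x" if "x \<in> {-1..1}" for x
    using assms(2)[OF that] by arith+
  have "zonal_mean e F \<le> zonal_mean e (\<lambda>_. B)"
    by (rule zonal_mean_mono[OF assms(1) continuous_on_const b(1)])
  moreover have "zonal_mean e (\<lambda>_. - B) \<le> zonal_mean e F"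
    by (rule zonal_mean_mono[OF continuous_on_const assms(1) b(2)])
  ultimately show ?thesis by (simp add: abs_le_iff)
qed

lemma continuous_comp_sphere_inner:
  fixes F :: "real \<Rightarrow> real"
  assumes "continuous_on UNIV F" "continuous_on S f" "continuous_on S g"
  shows "continuous_on S (\<lambda>x. F (sphere_inner d (f x) (g x)))"
  by (rule continuous_on_compose2[OF assms(1)]) (auto intro!: continuous_intros assms)

text \<open>
  Both sides depend on \<open>F\<close> linearly and are bounded by its maximum on \<open>[-1, 1]\<close>, so uniform
  approximation by polynomials carries the formula over.
\<close>

lemma funk_hecke:
  assumes s: "\<xi> \<in> unit_sphere (Suc e)" "\<eta> \<in> unit_sphere (Suc e)" and F: "continuous_on UNIV F"
  shows "(\<integral>\<zeta>. F (sphere_inner (Suc e) \<xi> \<zeta>) * poly (gegenbauer n e) (sphere_inner (Suc e) \<zeta> \<eta>) \<partial>sphere_measure (Suc e))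
    = zonal_mean e (\<lambda>x. F x * poly (gegenbauer n e) x) / poly (gegenbauer n e) 1
      * poly (gegenbauer n e) (sphere_inner (Suc e) \<xi> \<eta>)"
proof -
  define d where "d = Suc e"
  define q where "q = gegenbauer n e"
  define c where "c = poly q (sphere_inner d \<xi> \<eta>) / poly q 1"
  note s = s[folded d_def]
  define D where "D G = (\<integral>\<zeta>. G (sphere_inner d \<xi> \<zeta>) * poly q (sphere_inner d \<zeta> \<eta>) \<partial>sphere_measure d)
    - zonal_mean e (\<lambda>x. G x * poly q x) * c" for G
  have "compact (poly q ` {-1..1})"
    by (intro compact_continuous_image continuous_intros) auto
  then have "bounded (poly q ` {-1..1})" by (rule compact_imp_bounded)
  then obtain B0 where "\<forall>y\<in>poly q ` {-1..1}. norm y \<le> B0"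
    unfolding bounded_iff by blast
  then have B0: "\<bar>poly q x\<bar> \<le> B0" if "x \<in> {-1..1}" for x
    using that by auto
  have Dp: "D (poly p) = 0" for p
    using funk_hecke_poly[of \<xi> e \<eta> p n] s by (simp add: D_def c_def d_def q_def)
  have Dbound: "\<bar>D G\<bar> \<le> (B0 + B0 * \<bar>c\<bar>) * \<epsilon>"
    if G: "continuous_on UNIV G" "\<And>x. x \<in> {-1..1} \<Longrightarrow> \<bar>G x\<bar> \<le> \<epsilon>" for G \<epsilon>
  proof -
    have b: "\<bar>G x * poly q y\<bar> \<le> \<epsilon> * B0" if "x \<in> {-1..1}" "y \<in> {-1..1}" for x y
      unfolding abs_mult using G(2)[OF that(1)] B0[OF that(2)] by (intro mult_mono) auto
    have "\<bar>\<integral>\<zeta>. G (sphere_inner d \<xi> \<zeta>) * poly q (sphere_inner d \<zeta> \<eta>) \<partial>sphere_measure d\<bar> \<le> \<epsilon> * B0"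
      by (intro sphere_integral_bound b sphere_inner_in_Icc s continuous_intros continuous_comp_sphere_inner G)
    moreover have "\<bar>zonal_mean e (\<lambda>x. G x * poly q x)\<bar> \<le> \<epsilon> * B0"
      by (intro zonal_mean_bound b continuous_intros continuous_on_subset[OF G(1)]) auto
    then have "\<bar>zonal_mean e (\<lambda>x. G x * poly q x) * c\<bar> \<le> \<epsilon> * B0 * \<bar>c\<bar>"
      unfolding abs_mult by (intro mult_right_mono) auto
    ultimately show ?thesis unfolding D_def by (simp add: algebra_simps)
  qed
  have "\<bar>D F\<bar> \<le> (B0 + B0 * \<bar>c\<bar>) * \<epsilon>" if \<epsilon>: "\<epsilon> > 0" for \<epsilon>
  proof -
    obtain p where "\<forall>x\<in>{-1..1}. \<bar>F x - poly p x\<bar> < \<epsilon>"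
      using polynomial_approximation[OF continuous_on_subset[OF F subset_UNIV] \<epsilon>] by blast
    then have p: "\<bar>F x - poly p x\<bar> \<le> \<epsilon>" if "x \<in> {-1..1}" for x
      using that by (meson less_imp_le)
    have "D (\<lambda>x. F x - poly p x) = D F - D (poly p)"
    proof -
      have "(\<integral>\<zeta>. (F (sphere_inner d \<xi> \<zeta>) - poly p (sphere_inner d \<xi> \<zeta>)) * poly q (sphere_inner d \<zeta> \<eta>) \<partial>sphere_measure d)
        = (\<integral>\<zeta>. F (sphere_inner d \<xi> \<zeta>) * poly q (sphere_inner d \<zeta> \<eta>) \<partial>sphere_measure d)
         - (\<integral>\<zeta>. poly p (sphere_inner d \<xi> \<zeta>) * poly q (sphere_inner d \<zeta> \<eta>) \<partial>sphere_measure d)"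
        unfolding left_diff_distrib
        by (intro Bochner_Integration.integral_diff integrable_sphere_measure continuous_intros
            continuous_comp_sphere_inner F)
      moreover have "zonal_mean e (\<lambda>x. (F x - poly p x) * poly q x)
        = zonal_mean e (\<lambda>x. F x * poly q x) - zonal_mean e (\<lambda>x. poly p x * poly q x)"
        unfolding left_diff_distrib
        by (intro zonal_mean_diff continuous_intros continuous_on_subset[OF F]) auto
      moreover have "a - b - (u - v) * c = a - u * c - (b - v * c)" for a b u v :: real
        by (simp add: algebra_simps)
      ultimately show ?thesis by (simp only: D_def)
    qed
    moreover have "\<bar>D (\<lambda>x. F x - poly p x)\<bar> \<le> (B0 + B0 * \<bar>c\<bar>) * \<epsilon>"
      by (intro Dbound continuous_intros F) (rule p)
    ultimately show ?thesis by (simp add: Dp)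
  qed
  moreover have "B0 \<ge> 0" using B0[of 0] by simp
  ultimately have "D F = 0"
  proof -
    define C where "C = B0 + B0 * \<bar>c\<bar> + 1"
    have C: "C > 0" using \<open>B0 \<ge> 0\<close> by (simp add: C_def add_nonneg_pos)
    have "\<bar>D F\<bar> \<le> 0 + \<epsilon>" if "\<epsilon> > 0" for \<epsilon>
    proof -
      have "\<bar>D F\<bar> \<le> (B0 + B0 * \<bar>c\<bar>) * (\<epsilon> / C)"
        using that C by (intro \<open>\<And>\<epsilon>. \<epsilon> > 0 \<Longrightarrow> \<bar>D F\<bar> \<le> (B0 + B0 * \<bar>c\<bar>) * \<epsilon>\<close>) simp
      also have "\<dots> \<le> C * (\<epsilon> / C)"
        using that C by (intro mult_right_mono) (auto simp: C_def)
      finally show ?thesis using C by simp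
    qed
    then have "\<bar>D F\<bar> \<le> 0" by (rule field_le_epsilon)
    then show ?thesis by simp
  qed
  then show ?thesis by (simp add: D_def c_def d_def q_def)
qed

section \<open>Positive definite zonal kernels\<close>

text \<open>
  Averaging the defining sums of a positive definite kernel over \<open>m\<close> independent random points gives
  \<open>m\<^sup>2 * a + m * C \<ge> 0\<close>, where \<open>a\<close> is the double integral and \<open>C\<close> accounts for the diagonal; letting \<open>m\<close>
  grow forces \<open>a \<ge> 0\<close>. The points are averaged out one at a time, which is why the claim inside
  allows \<open>n\<close> points that are still fixed.
\<close>

lemma double_sphere_integral_nonneg:
  fixes K :: "(nat \<Rightarrow> real) \<Rightarrow> (nat \<Rightarrow> real) \<Rightarrow> real"
  assumes cont: "continuous_on UNIV (\<lambda>p. K (fst p) (snd p))"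
    and sym: "\<And>\<xi> \<eta>. K \<xi> \<eta> = K \<eta> \<xi>"
    and pos: "\<And>(n::nat) p. (\<And>i. i < n \<Longrightarrow> p i \<in> unit_sphere d) \<Longrightarrow> 0 \<le> (\<Sum>i<n. \<Sum>j<n. K (p i) (p j))"
  shows "0 \<le> (\<integral>\<xi>. (\<integral>\<zeta>. K \<xi> \<zeta> \<partial>sphere_measure d) \<partial>sphere_measure d)"
proof -
  interpret P: pair_prob_space "sphere_measure d" "sphere_measure d"
    by (rule pair_prob_space_sphere_measure)
  define \<phi> where "\<phi> \<xi> = (\<integral>\<zeta>. K \<xi> \<zeta> \<partial>sphere_measure d)" for \<xi>
  define a where "a = (\<integral>\<xi>. \<phi> \<xi> \<partial>sphere_measure d)"
  define C where "C = (\<integral>\<xi>. K \<xi> \<xi> \<partial>sphere_measure d) - a"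
  have i1: "integrable (sphere_measure d) (K \<xi>)" for \<xi>
    by (rule integrable_sphere_measure)
       (rule continuous_on_compose2[OF cont, of UNIV "\<lambda>\<zeta>. (\<xi>, \<zeta>)", simplified], intro continuous_intros)
  have i2: "integrable (sphere_measure d) (\<lambda>\<xi>. K \<xi> \<xi>)"
    by (rule integrable_sphere_measure)
       (rule continuous_on_compose2[OF cont, of UNIV "\<lambda>\<zeta>. (\<zeta>, \<zeta>)", simplified], intro continuous_intros)
  have i3: "integrable (sphere_measure d) \<phi>"
    unfolding \<phi>_def using P.integrable_fst'[OF integrable_sphere_measure_pair[OF cont]] by simp
  have claim: "0 \<le> (\<Sum>i<n. \<Sum>j<n. K (p i) (p j)) + 2 * real m * (\<Sum>i<n. \<phi> (p i)) + (real m)\<^sup>2 * a + real m * C"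
    if "\<And>i. i < n \<Longrightarrow> p i \<in> unit_sphere d" for m n :: nat and p
    using that
  proof (induction m arbitrary: n p)
    case 0
    then show ?case using pos[of n p] by simp
  next
    case (Suc m)
    \<comment> \<open>\<open>h \<xi>\<close> is the claim for \<open>m\<close> averaged points with \<open>\<xi>\<close> added to the fixed ones; averaging it over \<open>\<xi>\<close> gives the claim for \<open>m + 1\<close>.\<close>
    define S where "S = (\<Sum>i<n. \<Sum>j<n. K (p i) (p j))"
    define h where "h \<xi> = S + 2 * (\<Sum>i<n. K (p i) \<xi>) + K \<xi> \<xi>
        + 2 * real m * ((\<Sum>i<n. \<phi> (p i)) + \<phi> \<xi>) + (real m)\<^sup>2 * a + real m * C" for \<xi>
    have "0 \<le> h \<xi>" if \<xi>: "\<xi> \<in> unit_sphere d" for \<xi>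
    proof -
      define p' where "p' = p(n := \<xi>)"
      have "(\<Sum>j<n. K \<xi> (p j)) = (\<Sum>j<n. K (p j) \<xi>)"
        by (intro sum.cong refl sym)
      then have "(\<Sum>i<Suc n. \<Sum>j<Suc n. K (p' i) (p' j)) = S + 2 * (\<Sum>i<n. K (p i) \<xi>) + K \<xi> \<xi>"
        by (simp add: p'_def S_def sum.distrib)
      moreover have "(\<Sum>i<Suc n. \<phi> (p' i)) = (\<Sum>i<n. \<phi> (p i)) + \<phi> \<xi>"
        by (simp add: p'_def)
      moreover have "p' i \<in> unit_sphere d" if "i < Suc n" for i
        using that Suc.prems \<xi> by (auto simp: p'_def less_Suc_eq)
      ultimately show ?thesis
        using Suc.IH[of "Suc n" p'] unfolding h_def by simp
    qed
    then have "0 \<le> (\<integral>\<xi>. h \<xi> \<partial>sphere_measure d)"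
      by (intro integral_nonneg_AE eventually_mono[OF AE_sphere_measure])
    also have "(\<integral>\<xi>. h \<xi> \<partial>sphere_measure d) = S + 2 * (\<Sum>i<n. \<phi> (p i)) + (C + a)
        + 2 * real m * ((\<Sum>i<n. \<phi> (p i)) + a) + (real m)\<^sup>2 * a + real m * C"
    proof -
      have "(\<integral>\<xi>. (\<Sum>i<n. K (p i) \<xi>) \<partial>sphere_measure d) = (\<Sum>i<n. \<phi> (p i))"
        unfolding \<phi>_def by (rule Bochner_Integration.integral_sum) (rule i1)
      moreover have "integrable (sphere_measure d) (\<lambda>\<xi>. \<Sum>i<n. K (p i) \<xi>)"
        by (rule Bochner_Integration.integrable_sum) (rule i1)
      ultimately show ?thesis
        unfolding h_def using i2 i3
        by (simp add: P.M1.prob_space[simplified] C_def a_def)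
    qed
    also have "\<dots> = S + 2 * real (Suc m) * (\<Sum>i<n. \<phi> (p i)) + (real (Suc m))\<^sup>2 * a + real (Suc m) * C"
      by (simp add: algebra_simps power2_eq_square)
    finally show ?case by (simp add: S_def)
  qed
  have "0 \<le> a"
  proof (rule ccontr)
    assume a: "\<not> 0 \<le> a"
    obtain m where m: "real m > max 0 (C / (- a))" using reals_Archimedean2 by blast
    have "C < real m * (- a)" using m a by (simp add: field_simps)
    then have "real m * (real m * a + C) < 0" using m by (intro mult_pos_neg) auto
    moreover have "0 \<le> (real m)\<^sup>2 * a + real m * C" using claim[of 0 "\<lambda>_ _. 0" m] by simp
    ultimately show False by (simp add: algebra_simps power2_eq_square)
  qed
  then show ?thesis by (simp add: a_def \<phi>_def)
qed

text \<open>
  Real weights suffice: a zonal kernel is symmetric.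
\<close>

definition zonal_positive_definite :: "nat \<Rightarrow> (real \<Rightarrow> real) \<Rightarrow> bool"
  where "zonal_positive_definite d F \<longleftrightarrow>
    (\<forall>n (p :: nat \<Rightarrow> nat \<Rightarrow> real) (c :: nat \<Rightarrow> real). (\<forall>i<n. p i \<in> unit_sphere d) \<longrightarrow>
      0 \<le> (\<Sum>i<n. \<Sum>j<n. c i * c j * F (sphere_inner d (p i) (p j))))"

text \<open>
  Weight the kernel by the Gegenbauer polynomial centred at a pole \<open>\<eta>\<close>. The inner integral is a
  Funk--Hecke convolution, so the nonnegative double integral is the coefficient times the mean square
  of the polynomial, up to the positive value at \<open>1\<close>.
\<close>

lemma gegenbauer_coefficient_nonneg:
  assumes F: "continuous_on UNIV F" and pd: "zonal_positive_definite (Suc e) F"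
  shows "0 \<le> zonal_mean e (\<lambda>x. F x * poly (gegenbauer n e) x)"
proof -
  define d where "d = Suc e"
  define q where "q = gegenbauer n e"
  obtain \<eta> where \<eta>: "\<eta> \<in> unit_sphere d" using unit_sphere_nonempty by blast
  define \<gamma> where "\<gamma> = zonal_mean e (\<lambda>x. F x * poly q x) / poly q 1"
  define K where "K \<xi> \<zeta> = poly q (sphere_inner d \<xi> \<eta>) * (F (sphere_inner d \<xi> \<zeta>) * poly q (sphere_inner d \<zeta> \<eta>))" for \<xi> \<zeta>
  have cK: "continuous_on UNIV (\<lambda>p. K (fst p) (snd p))"
    unfolding K_def by (intro continuous_intros continuous_comp_sphere_inner F)
  have "0 \<le> (\<integral>\<xi>. (\<integral>\<zeta>. K \<xi> \<zeta> \<partial>sphere_measure d) \<partial>sphere_measure d)"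
  proof (rule double_sphere_integral_nonneg[OF cK])
    show "K \<xi> \<zeta> = K \<zeta> \<xi>" for \<xi> \<zeta>
      unfolding K_def sphere_inner_commute[of d \<xi> \<zeta>] by (simp only: mult_ac)
    fix n and p :: "nat \<Rightarrow> nat \<Rightarrow> real" assume "\<And>i. i < n \<Longrightarrow> p i \<in> unit_sphere d"
    then have "0 \<le> (\<Sum>i<n. \<Sum>j<n. poly q (sphere_inner d (p i) \<eta>) * poly q (sphere_inner d (p j) \<eta>) * F (sphere_inner d (p i) (p j)))"
      using pd[unfolded zonal_positive_definite_def, rule_format, of n p "\<lambda>i. poly q (sphere_inner d (p i) \<eta>)"]
      by (simp add: d_def)
    moreover have "poly q (sphere_inner d (p i) \<eta>) * poly q (sphere_inner d (p j) \<eta>) * F (sphere_inner d (p i) (p j))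
        = K (p i) (p j)" for i j
      by (simp add: K_def)
    ultimately show "0 \<le> (\<Sum>i<n. \<Sum>j<n. K (p i) (p j))"
      by (simp only:)
  qed
  also have "(\<integral>\<xi>. (\<integral>\<zeta>. K \<xi> \<zeta> \<partial>sphere_measure d) \<partial>sphere_measure d)
      = (\<integral>\<xi>. poly (smult \<gamma> (q * q)) (sphere_inner d \<xi> \<eta>) \<partial>sphere_measure d)"
  proof (rule sphere_integral_cong)
    fix \<xi> assume \<xi>: "\<xi> \<in> unit_sphere d"
    show "(\<integral>\<zeta>. K \<xi> \<zeta> \<partial>sphere_measure d) = poly (smult \<gamma> (q * q)) (sphere_inner d \<xi> \<eta>)"
      using funk_hecke[of \<xi> e \<eta> F n] \<xi> \<eta> F by (simp add: K_def \<gamma>_def d_def q_def)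
  next
    show "(\<lambda>\<xi>. \<integral>\<zeta>. K \<xi> \<zeta> \<partial>sphere_measure d) \<in> borel_measurable (sphere_measure d)"
      by (rule measurable_sphere_integral[OF cK])
    show "(\<lambda>\<xi>. poly (smult \<gamma> (q * q)) (sphere_inner d \<xi> \<eta>)) \<in> borel_measurable (sphere_measure d)"
      by (intro measurable_sphere_continuous continuous_intros)
  qed
  also have "\<dots> = zonal_mean e (\<lambda>x. \<gamma> * (poly q x * poly q x))"
    unfolding d_def by (subst sphere_integral_zonal_poly[OF \<eta>[unfolded d_def]]) (rule zonal_mean_cong, simp)
  also have "\<dots> = \<gamma> * zonal_mean e (\<lambda>x. poly q x * poly q x)"
    by (rule zonal_mean_cmult)
  finally have "0 \<le> \<gamma>"
    using gegenbauer_square_pos[of e n] by (simp add: q_def zero_le_mult_iff)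
  then show ?thesis
    using gegenbauer_at_1_pos[of n e] by (simp add: \<gamma>_def q_def zero_le_divide_iff)
qed

section \<open>Analysis and synthesis of matrix-valued zonal functions\<close>

text \<open>
  By Funk--Hecke the Gegenbauer kernel is a positive multiple of its own convolution square, an integral
  over \<open>\<zeta>\<close> of rank-one matrices. For fixed \<open>\<zeta>\<close> the factors are absorbed into the weights \<open>c\<close>.
\<close>

lemma gegenbauer_schur_product:
  fixes B :: "nat \<Rightarrow> nat \<Rightarrow> real"
  assumes \<xi>: "\<And>i. i < N \<Longrightarrow> \<xi> i \<in> unit_sphere (Suc e)"
    and B: "\<And>a. 0 \<le> (\<Sum>i<N. \<Sum>j<N. a i * a j * B i j)"
  shows "0 \<le> (\<Sum>i<N. \<Sum>j<N. c i * c j * (B i j * poly (gegenbauer n e) (sphere_inner (Suc e) (\<xi> i) (\<xi> j))))"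
proof -
  define d where "d = Suc e"
  define q where "q = gegenbauer n e"
  define \<gamma> where "\<gamma> = poly q 1 / zonal_mean e (\<lambda>x. poly q x * poly q x)"
  have pos: "poly q 1 > 0" "zonal_mean e (\<lambda>x. poly q x * poly q x) > 0"
    by (simp_all add: q_def gegenbauer_at_1_pos gegenbauer_square_pos)
  have rep: "poly q (sphere_inner d (\<xi> i) (\<xi> j))
      = \<gamma> * (\<integral>\<zeta>. poly q (sphere_inner d (\<xi> i) \<zeta>) * poly q (sphere_inner d \<zeta> (\<xi> j)) \<partial>sphere_measure d)"
    if "i < N" "j < N" for i j
    using funk_hecke_poly[OF \<xi>[OF that(1)] \<xi>[OF that(2)], of q n] pos
    by (simp add: \<gamma>_def q_def d_def)
  define I where "I i j = (\<integral>\<zeta>. poly q (sphere_inner d (\<xi> i) \<zeta>) * poly q (sphere_inner d \<zeta> (\<xi> j)) \<partial>sphere_measure d)" for i j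
  have "(\<Sum>i<N. \<Sum>j<N. c i * c j * (B i j * poly q (sphere_inner d (\<xi> i) (\<xi> j))))
      = (\<Sum>i<N. \<Sum>j<N. \<gamma> * (c i * c j * B i j * I i j))"
    by (intro sum.cong refl) (simp add: rep I_def)
  also have "\<dots> = \<gamma> * (\<Sum>i<N. \<Sum>j<N. c i * c j * B i j * I i j)"
    by (simp add: sum_distrib_left)
  also have "(\<Sum>i<N. \<Sum>j<N. c i * c j * B i j * I i j)
      = (\<integral>\<zeta>. (\<Sum>i<N. \<Sum>j<N. c i * c j * B i j *
          (poly q (sphere_inner d (\<xi> i) \<zeta>) * poly q (sphere_inner d \<zeta> (\<xi> j)))) \<partial>sphere_measure d)"
  proof -
    have int: "integrable (sphere_measure d) (\<lambda>\<zeta>. c i * c j * B i j *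
        (poly q (sphere_inner d (\<xi> i) \<zeta>) * poly q (sphere_inner d \<zeta> (\<xi> j))))" for i j
      by (intro integrable_sphere_measure continuous_intros)
    show ?thesis
      by (subst Bochner_Integration.integral_sum, intro Bochner_Integration.integrable_sum int,
          intro sum.cong refl, subst Bochner_Integration.integral_sum, rule int, simp add: I_def)
  qed
  also have "0 \<le> \<gamma> * \<dots>"
  proof (intro mult_nonneg_nonneg Bochner_Integration.integral_nonneg)
    show "0 \<le> \<gamma>" using pos by (simp add: \<gamma>_def)
    fix \<zeta>
    have "(\<Sum>i<N. \<Sum>j<N. c i * c j * B i j * (poly q (sphere_inner d (\<xi> i) \<zeta>) * poly q (sphere_inner d \<zeta> (\<xi> j))))
      = (\<Sum>i<N. \<Sum>j<N. (c i * poly q (sphere_inner d \<zeta> (\<xi> i))) * (c j * poly q (sphere_inner d \<zeta> (\<xi> j))) * B i j)"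
      by (intro sum.cong refl) (simp add: sphere_inner_commute[of d "\<xi> _" \<zeta>])
    then show "0 \<le> (\<Sum>i<N. \<Sum>j<N. c i * c j * B i j * (poly q (sphere_inner d (\<xi> i) \<zeta>) * poly q (sphere_inner d \<zeta> (\<xi> j))))"
      using B[of "\<lambda>i. c i * poly q (sphere_inner d \<zeta> (\<xi> i))"] by (simp only:)
  qed
  finally show ?thesis by (simp add: q_def d_def)
qed

text \<open>
  Multiplying a kernel by \<open>1 + \<langle>\<xi>, \<eta>\<rangle>\<close> adds to it one copy for each coordinate, in which that coordinate
  is absorbed into the weights.
\<close>

lemma zonal_positive_definite_one_plus_power: "zonal_positive_definite d (poly ([:1, 1:] ^ m))"
proof (induction m)
  case 0
  have "(\<Sum>i<n. \<Sum>j<n. c i * c j) = (\<Sum>i<n. c i) * (\<Sum>i<n. c i)" for n and c :: "nat \<Rightarrow> real"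
    by (simp add: sum_product)
  then show ?case by (simp add: zonal_positive_definite_def)
next
  case (Suc m)
  show ?case unfolding zonal_positive_definite_def
  proof (intro allI impI)
    fix n and p :: "nat \<Rightarrow> nat \<Rightarrow> real" and c :: "nat \<Rightarrow> real"
    assume p: "\<forall>i<n. p i \<in> unit_sphere d"
    define K where "K i j = poly ([:1, 1:] ^ m) (sphere_inner d (p i) (p j))" for i j
    have IH: "0 \<le> (\<Sum>i<n. \<Sum>j<n. a i * a j * K i j)" for a
      using Suc[unfolded zonal_positive_definite_def, rule_format, of n p a] p by (simp add: K_def)
    have "(\<Sum>i<n. \<Sum>j<n. c i * c j * poly ([:1, 1:] ^ Suc m) (sphere_inner d (p i) (p j)))
       = (\<Sum>i<n. \<Sum>j<n. c i * c j * K i j + (\<Sum>k\<le>d. (c i * p i k) * (c j * p j k) * K i j))"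
      by (intro sum.cong refl)
         (simp add: K_def sphere_inner_def sum_distrib_left sum_distrib_right algebra_simps)
    also have "\<dots> = (\<Sum>i<n. \<Sum>j<n. c i * c j * K i j) + (\<Sum>k\<le>d. \<Sum>i<n. \<Sum>j<n. (c i * p i k) * (c j * p j k) * K i j)"
    proof -
      have "(\<Sum>i<n. \<Sum>j<n. \<Sum>k\<le>d. (c i * p i k) * (c j * p j k) * K i j)
          = (\<Sum>i<n. \<Sum>k\<le>d. \<Sum>j<n. (c i * p i k) * (c j * p j k) * K i j)"
        by (intro sum.cong refl sum.swap)
      also have "\<dots> = (\<Sum>k\<le>d. \<Sum>i<n. \<Sum>j<n. (c i * p i k) * (c j * p j k) * K i j)"
        by (rule sum.swap)
      finally show ?thesis by (simp add: sum.distrib)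
    qed
    also have "0 \<le> \<dots>" by (intro add_nonneg_nonneg sum_nonneg IH)
    finally show "0 \<le> (\<Sum>i<n. \<Sum>j<n. c i * c j * poly ([:1, 1:] ^ Suc m) (sphere_inner d (p i) (p j)))" .
  qed
qed

lemma one_plus_power_gegenbauer_expansion:
  "\<exists>k. (\<forall>n. 0 \<le> k n) \<and> [:1, 1:] ^ m = (\<Sum>n\<le>m. smult (k n) (gegenbauer n e))"
proof -
  let ?p = "[:1, 1:] ^ m :: real poly"
  have deg: "degree ?p \<le> m" using degree_power_le[of "[:1, 1:] :: real poly" m] by simp
  show ?thesis
  proof (intro exI conjI allI)
    show "?p = (\<Sum>n\<le>m. smult (zonal_mean e (\<lambda>x. poly ?p x * poly (gegenbauer n e) x)
      / zonal_mean e (\<lambda>x. poly (gegenbauer n e) x * poly (gegenbauer n e) x)) (gegenbauer n e))"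
      by (rule gegenbauer_expansion[OF deg])
    show "0 \<le> zonal_mean e (\<lambda>x. poly ?p x * poly (gegenbauer n e) x)
      / zonal_mean e (\<lambda>x. poly (gegenbauer n e) x * poly (gegenbauer n e) x)" for n
      by (intro divide_nonneg_pos gegenbauer_square_pos gegenbauer_coefficient_nonneg
          zonal_positive_definite_one_plus_power continuous_intros)
  qed
qed

lemma one_plus_power_mean_pos: "zonal_mean e (poly ([:1, 1:] ^ m)) > 0"
proof -
  have nn: "0 \<le> poly ([:1, 1:] ^ m) x" if "x \<in> {-1..1}" for x :: real
    using that by simp
  have c: "continuous_on {-1..1} (poly ([:1, 1:] ^ m :: real poly))" by (intro continuous_intros)
  have "zonal_mean e (\<lambda>_. 0) \<le> zonal_mean e (poly ([:1, 1:] ^ m))"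
    by (rule zonal_mean_mono) (use nn c in auto)
  moreover have "zonal_mean e (poly ([:1, 1:] ^ m)) \<noteq> 0"
  proof
    assume "zonal_mean e (poly ([:1, 1:] ^ m)) = 0"
    from zonal_mean_eq_0_D[OF c _ this, of 0] have "poly ([:1, 1:] ^ m) (0::real) = 0"
      using nn by auto
    then show False by simp
  qed
  ultimately show ?thesis by simp
qed

text \<open>
  The mean of \<open>1 - x\<close> under the density proportional to \<open>(1 + x) ^ m\<close> is of order \<open>1 / m\<close>, so this density
  concentrates at \<open>x = 1\<close>.
\<close>

lemma one_plus_power_concentration:
  "real m * zonal_mean e (poly ([:1, -1:] * [:1, 1:] ^ m)) \<le> (real e + 1) * zonal_mean e (poly ([:1, 1:] ^ m))"
proof -
  have "real m * zonal_mean e (poly ([:1, -1:] * [:1, 1:] ^ m))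
      = zonal_mean e (\<lambda>x. (1 - x\<^sup>2) * (real m * (1 + x) ^ (m - 1)))"
  proof (cases m)
    case (Suc k)
    show ?thesis
      by (subst zonal_mean_cmult[symmetric], rule zonal_mean_cong)
         (simp add: Suc power2_eq_square algebra_simps)
  qed simp
  also have "\<dots> = (real e + 1) * zonal_mean e (\<lambda>x. x * (1 + x) ^ m)"
    by (rule zonal_mean_stein[symmetric]) (auto intro!: derivative_eq_intros continuous_intros)
  also have "\<dots> \<le> (real e + 1) * zonal_mean e (poly ([:1, 1:] ^ m))"
  proof (intro mult_left_mono zonal_mean_mono)
    fix x :: real assume x: "x \<in> {-1..1}"
    then have "x * (1 + x) ^ m \<le> 1 * (1 + x) ^ m" by (intro mult_right_mono) auto
    then show "x * (1 + x) ^ m \<le> poly ([:1, 1:] ^ m) x" by simp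
  qed (auto intro!: continuous_intros)
  finally show ?thesis .
qed

lemma sphere_inner_lipschitz:
  assumes "\<xi> \<in> unit_sphere d" "\<zeta> \<in> unit_sphere d" "\<eta> \<in> unit_sphere d"
  shows "(sphere_inner d \<xi> \<zeta> - sphere_inner d \<xi> \<eta>)\<^sup>2 \<le> 2 * (1 - sphere_inner d \<zeta> \<eta>)"
proof -
  have "(\<Sum>i\<le>d. \<xi> i * (\<zeta> i - \<eta> i))\<^sup>2 \<le> (\<Sum>i\<le>d. (\<xi> i)\<^sup>2) * (\<Sum>i\<le>d. (\<zeta> i - \<eta> i)\<^sup>2)"
    by (rule Cauchy_Schwarz_ineq_sum)
  moreover have "(\<Sum>i\<le>d. \<xi> i * (\<zeta> i - \<eta> i)) = sphere_inner d \<xi> \<zeta> - sphere_inner d \<xi> \<eta>"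
    by (simp add: sphere_inner_def right_diff_distrib sum_subtractf)
  moreover have "(\<Sum>i\<le>d. (\<zeta> i - \<eta> i)\<^sup>2) = sphere_inner d \<zeta> \<zeta> + sphere_inner d \<eta> \<eta> - 2 * sphere_inner d \<zeta> \<eta>"
    by (simp add: sphere_inner_def power2_eq_square algebra_simps sum.distrib sum_subtractf sum_distrib_left)
  moreover have "(\<Sum>i\<le>d. (\<xi> i)\<^sup>2) = 1"
    using sphere_inner_self[OF assms(1)] by (simp add: sphere_inner_def power2_eq_square)
  ultimately show ?thesis
    using sphere_inner_self[OF assms(2)] sphere_inner_self[OF assms(3)] by simp
qed

text \<open>
  Korovkin's argument. Continuity and boundedness give \<open>\<bar>F x - F x0\<bar> \<le> \<epsilon> / 2 + C * (x - x0)\<^sup>2\<close>. At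
  \<open>x = \<langle>\<xi>, \<zeta>\<rangle>\<close> and \<open>x0 = \<langle>\<xi>, \<eta>\<rangle>\<close> the square is at most \<open>2 * (1 - \<langle>\<zeta>, \<eta>\<rangle>)\<close>, whose mean under the
  normalised kernel tends to zero.
\<close>

lemma zonal_approximate_identity:
  assumes s: "\<xi> \<in> unit_sphere (Suc e)" "\<eta> \<in> unit_sphere (Suc e)" and F: "continuous_on UNIV F"
  shows "(\<lambda>m. (\<integral>\<zeta>. F (sphere_inner (Suc e) \<xi> \<zeta>) * poly ([:1, 1:] ^ m) (sphere_inner (Suc e) \<zeta> \<eta>) \<partial>sphere_measure (Suc e))
      / zonal_mean e (poly ([:1, 1:] ^ m))) \<longlonglongrightarrow> F (sphere_inner (Suc e) \<xi> \<eta>)"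
proof (rule LIMSEQ_I)
  define d where "d = Suc e"
  note s = s[folded d_def]
  define x0 where "x0 = sphere_inner d \<xi> \<eta>"
  have x0: "x0 \<in> {-1..1}" unfolding x0_def by (rule sphere_inner_in_Icc[OF s])
  fix \<epsilon> :: real assume \<epsilon>: "\<epsilon> > 0"
  have "compact (F ` {-1..1})"
    by (intro compact_continuous_image continuous_on_subset[OF F]) auto
  then have "bounded (F ` {-1..1})" by (rule compact_imp_bounded)
  then obtain B where "\<forall>y\<in>F ` {-1..1}. norm y \<le> B"
    unfolding bounded_iff by blast
  then have B: "\<bar>F x\<bar> \<le> B" if "x \<in> {-1..1}" for x
    using that by auto
  obtain \<delta> where \<delta>: "\<delta> > 0" "\<And>x. \<bar>x - x0\<bar> < \<delta> \<Longrightarrow> \<bar>F x - F x0\<bar> < \<epsilon> / 2"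
    using F[unfolded continuous_on_iff dist_real_def, rule_format, of x0 "\<epsilon> / 2"] \<epsilon> by auto
  \<comment> \<open>Away from \<open>x0\<close> the quadratic term alone must exceed the oscillation \<open>2 * B\<close>.\<close>
  define C where "C = 2 * B / \<delta>\<^sup>2"
  have C: "C \<ge> 0" using B[of 0] by (simp add: C_def)
  have mod: "\<bar>F x - F x0\<bar> \<le> \<epsilon> / 2 + C * (x - x0)\<^sup>2" if x: "x \<in> {-1..1}" for x
  proof (cases "\<bar>x - x0\<bar> < \<delta>")
    case True
    have "0 \<le> C * (x - x0)\<^sup>2" using C by simp
    then show ?thesis using \<delta>(2)[OF True] by linarith
  next
    case False
    then have "\<delta>\<^sup>2 \<le> (x - x0)\<^sup>2" using \<delta>(1) abs_le_square_iff[of \<delta> "x - x0"] by simp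
    then have "C * \<delta>\<^sup>2 \<le> C * (x - x0)\<^sup>2" using C by (rule mult_left_mono)
    moreover have "C * \<delta>\<^sup>2 = 2 * B" using \<delta>(1) by (simp add: C_def)
    ultimately have "2 * B \<le> C * (x - x0)\<^sup>2" by simp
    moreover have "\<bar>F x - F x0\<bar> \<le> 2 * B" using B[OF x] B[OF x0] by arith
    ultimately show ?thesis using \<epsilon> by linarith
  qed
  \<comment> \<open>From this \<open>M\<close> on, the concentration bound makes the quadratic term less than \<open>\<epsilon> / 2\<close>.\<close>
  obtain M where M: "real M > 4 * C * (real e + 1) / \<epsilon>" using reals_Archimedean2 by blast
  have main: "norm ((\<integral>\<zeta>. F (sphere_inner d \<xi> \<zeta>) * poly ([:1, 1:] ^ m) (sphere_inner d \<zeta> \<eta>) \<partial>sphere_measure d)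
      / zonal_mean e (poly ([:1, 1:] ^ m)) - F x0) < \<epsilon>" if m: "m \<ge> Suc M" for m
  proof -
    define p where "p = ([:1, 1:] ^ m :: real poly)"
    define A where "A = zonal_mean e (poly p)"
    have A: "A > 0" unfolding A_def p_def by (rule one_plus_power_mean_pos)
    have mpos: "real m > 0" using m by simp
    have pnn: "0 \<le> poly p x" if "x \<in> {-1..1}" for x using that by (simp add: p_def)
    note ci = continuous_intros continuous_comp_sphere_inner[OF F]
    have Aint: "A = (\<integral>\<zeta>. poly p (sphere_inner d \<zeta> \<eta>) \<partial>sphere_measure d)"
      unfolding A_def d_def by (rule sphere_integral_zonal_poly[symmetric]) (use s in \<open>simp add: d_def\<close>)
    define L where "L = (\<integral>\<zeta>. F (sphere_inner d \<xi> \<zeta>) * poly p (sphere_inner d \<zeta> \<eta>) \<partial>sphere_measure d)"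
    have "L - F x0 * A = (\<integral>\<zeta>. (F (sphere_inner d \<xi> \<zeta>) - F x0) * poly p (sphere_inner d \<zeta> \<eta>) \<partial>sphere_measure d)"
      unfolding L_def Aint left_diff_distrib
      by (subst Bochner_Integration.integral_diff) (intro integrable_sphere_measure ci | simp)+
    also have "\<bar>\<dots>\<bar> \<le> (\<integral>\<zeta>. \<bar>(F (sphere_inner d \<xi> \<zeta>) - F x0) * poly p (sphere_inner d \<zeta> \<eta>)\<bar> \<partial>sphere_measure d)"
      by (rule integral_abs_bound)
    also have "\<dots> \<le> (\<integral>\<zeta>. poly (smult (\<epsilon> / 2) p + smult (2 * C) ([:1, -1:] * p)) (sphere_inner d \<zeta> \<eta>) \<partial>sphere_measure d)"
    proof (rule integral_mono_AE)
      show "integrable (sphere_measure d) (\<lambda>\<zeta>. \<bar>(F (sphere_inner d \<xi> \<zeta>) - F x0) * poly p (sphere_inner d \<zeta> \<eta>)\<bar>)"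
        by (intro integrable_sphere_measure ci)
      show "integrable (sphere_measure d) (\<lambda>\<zeta>. poly (smult (\<epsilon> / 2) p + smult (2 * C) ([:1, -1:] * p)) (sphere_inner d \<zeta> \<eta>))"
        by (intro integrable_sphere_measure continuous_intros)
      show "AE \<zeta> in sphere_measure d. \<bar>(F (sphere_inner d \<xi> \<zeta>) - F x0) * poly p (sphere_inner d \<zeta> \<eta>)\<bar>
        \<le> poly (smult (\<epsilon> / 2) p + smult (2 * C) ([:1, -1:] * p)) (sphere_inner d \<zeta> \<eta>)"
      proof (rule eventually_mono[OF AE_sphere_measure])
        fix \<zeta> assume \<zeta>: "\<zeta> \<in> unit_sphere d"
        let ?y = "sphere_inner d \<zeta> \<eta>"
        have "\<bar>F (sphere_inner d \<xi> \<zeta>) - F x0\<bar> \<le> \<epsilon> / 2 + C * (sphere_inner d \<xi> \<zeta> - x0)\<^sup>2"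
          by (rule mod[OF sphere_inner_in_Icc[OF s(1) \<zeta>]])
        also have "\<dots> \<le> \<epsilon> / 2 + C * (2 * (1 - ?y))"
          unfolding x0_def using C sphere_inner_lipschitz[OF s(1) \<zeta> s(2)]
          by (intro add_left_mono mult_left_mono)
        finally have "\<bar>F (sphere_inner d \<xi> \<zeta>) - F x0\<bar> * \<bar>poly p ?y\<bar> \<le> (\<epsilon> / 2 + C * (2 * (1 - ?y))) * \<bar>poly p ?y\<bar>"
          by (rule mult_right_mono) simp
        moreover have "\<bar>poly p ?y\<bar> = poly p ?y"
          using pnn[OF sphere_inner_in_Icc[OF \<zeta> s(2)]] by simp
        ultimately show "\<bar>(F (sphere_inner d \<xi> \<zeta>) - F x0) * poly p ?y\<bar>
            \<le> poly (smult (\<epsilon> / 2) p + smult (2 * C) ([:1, -1:] * p)) ?y"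
          unfolding abs_mult by (simp add: algebra_simps)
      qed
    qed
    also have "\<dots> = zonal_mean e (poly (smult (\<epsilon> / 2) p + smult (2 * C) ([:1, -1:] * p)))"
      unfolding d_def by (rule sphere_integral_zonal_poly) (use s in \<open>simp add: d_def\<close>)
    also have "\<dots> = zonal_mean e (\<lambda>x. \<epsilon> / 2 * poly p x + 2 * C * poly ([:1, -1:] * p) x)"
      by (rule zonal_mean_cong) simp
    also have "\<dots> = \<epsilon> / 2 * A + 2 * C * zonal_mean e (poly ([:1, -1:] * p))"
    proof -
      have "zonal_mean e (\<lambda>x. \<epsilon> / 2 * poly p x + 2 * C * poly ([:1, -1:] * p) x)
          = zonal_mean e (\<lambda>x. \<epsilon> / 2 * poly p x) + zonal_mean e (\<lambda>x. 2 * C * poly ([:1, -1:] * p) x)"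
        by (intro zonal_mean_add continuous_intros)
      then show ?thesis unfolding A_def by (simp only: zonal_mean_cmult)
    qed
    also have "\<dots> \<le> \<epsilon> / 2 * A + 2 * C * ((real e + 1) * A / real m)"
    proof (intro add_left_mono mult_left_mono)
      show "zonal_mean e (poly ([:1, -1:] * p)) \<le> (real e + 1) * A / real m"
        using one_plus_power_concentration[of m e] mpos
        unfolding A_def p_def by (subst pos_le_divide_eq) (simp_all only: mult.commute)
    qed (use C in simp)
    also have "\<dots> < \<epsilon> / 2 * A + \<epsilon> / 2 * A"
    proof -
      have "4 * C * (real e + 1) / \<epsilon> < real m" using M m by linarith
      then have "2 * C * ((real e + 1) / real m) < \<epsilon> / 2"
        using \<epsilon> mpos by (simp add: field_simps)
      then have "2 * C * ((real e + 1) / real m) * A < \<epsilon> / 2 * A"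
        using A by (rule mult_strict_right_mono)
      moreover have "2 * C * ((real e + 1) * A / real m) = 2 * C * ((real e + 1) / real m) * A" by simp
      ultimately show ?thesis by linarith
    qed
    also have "\<dots> = \<epsilon> * A" by simp
    finally have "\<bar>L - F x0 * A\<bar> / A < \<epsilon>"
      using A by (subst pos_divide_less_eq)
    moreover have "L / A - F x0 = (L - F x0 * A) / A" using A by (simp add: diff_divide_distrib)
    then have "\<bar>L / A - F x0\<bar> = \<bar>L - F x0 * A\<bar> / A"
      using A by simp
    ultimately show ?thesis unfolding L_def A_def p_def real_norm_def by (simp only:)
  qed
  show "\<exists>no. \<forall>m\<ge>no. norm ((\<integral>\<zeta>. F (sphere_inner (Suc e) \<xi> \<zeta>) * poly ([:1, 1:] ^ m) (sphere_inner (Suc e) \<zeta> \<eta>) \<partial>sphere_measure (Suc e))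
      / zonal_mean e (poly ([:1, 1:] ^ m)) - F (sphere_inner (Suc e) \<xi> \<eta>)) < \<epsilon>"
    by (intro exI[of _ "Suc M"] allI impI main[unfolded d_def x0_def])
qed

text \<open>
  The smoothed sums are nonnegative: expand \<open>(1 + x) ^ m\<close> in Gegenbauer polynomials with nonnegative
  coefficients; by Funk--Hecke each of them contributes a coefficient matrix multiplied entrywise by a
  Gegenbauer kernel. The sums to be estimated are their limits as \<open>m\<close> grows.
\<close>

lemma zonal_synthesis:
  fixes G :: "nat \<Rightarrow> nat \<Rightarrow> real \<Rightarrow> real"
  assumes cont: "\<And>i j. continuous_on UNIV (G i j)"
    and coeff: "\<And>n a. 0 \<le> (\<Sum>i<N. \<Sum>j<N. a i * a j * zonal_mean e (\<lambda>x. G i j x * poly (gegenbauer n e) x))"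
    and \<xi>: "\<And>i. i < N \<Longrightarrow> \<xi> i \<in> unit_sphere (Suc e)"
  shows "0 \<le> (\<Sum>i<N. \<Sum>j<N. c i * c j * G i j (sphere_inner (Suc e) (\<xi> i) (\<xi> j)))"
proof -
  define d where "d = Suc e"
  define T where "T m i j = (\<integral>\<zeta>. G i j (sphere_inner d (\<xi> i) \<zeta>) * poly ([:1, 1:] ^ m) (sphere_inner d \<zeta> (\<xi> j)) \<partial>sphere_measure d)" for m i j
  define A where "A m = zonal_mean e (poly ([:1, 1:] ^ m))" for m
  have lim: "(\<lambda>m. \<Sum>i<N. \<Sum>j<N. c i * c j * (T m i j / A m)) \<longlonglongrightarrow>
      (\<Sum>i<N. \<Sum>j<N. c i * c j * G i j (sphere_inner d (\<xi> i) (\<xi> j)))"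
    unfolding T_def A_def d_def
    by (intro tendsto_sum tendsto_mult_left zonal_approximate_identity \<xi> cont) auto
  have "0 \<le> (\<Sum>i<N. \<Sum>j<N. c i * c j * (T m i j / A m))" for m
  proof -
    obtain k where k: "\<And>n. 0 \<le> k n" "[:1, 1:] ^ m = (\<Sum>n\<le>m. smult (k n) (gegenbauer n e))"
      using one_plus_power_gegenbauer_expansion by metis
    define b where "b n i j = zonal_mean e (\<lambda>x. G i j x * poly (gegenbauer n e) x)" for n i j
    define w where "w n = k n / poly (gegenbauer n e) 1" for n
    have w: "0 \<le> w n" for n
      unfolding w_def by (intro divide_nonneg_pos k(1) gegenbauer_at_1_pos)
    have Tij: "T m i j = (\<Sum>n\<le>m. w n * (b n i j * poly (gegenbauer n e) (sphere_inner d (\<xi> i) (\<xi> j))))"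
      if "i < N" "j < N" for i j
    proof -
      have "T m i j = (\<integral>\<zeta>. (\<Sum>n\<le>m. k n * (G i j (sphere_inner d (\<xi> i) \<zeta>) * poly (gegenbauer n e) (sphere_inner d \<zeta> (\<xi> j)))) \<partial>sphere_measure d)"
        unfolding T_def k(2) by (simp add: poly_sum sum_distrib_left mult_ac)
      also have "\<dots> = (\<Sum>n\<le>m. \<integral>\<zeta>. k n * (G i j (sphere_inner d (\<xi> i) \<zeta>) * poly (gegenbauer n e) (sphere_inner d \<zeta> (\<xi> j))) \<partial>sphere_measure d)"
        by (rule Bochner_Integration.integral_sum)
           (intro integrable_sphere_measure continuous_intros continuous_comp_sphere_inner[OF cont])
      also have "\<dots> = (\<Sum>n\<le>m. w n * (b n i j * poly (gegenbauer n e) (sphere_inner d (\<xi> i) (\<xi> j))))"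
        unfolding d_def by (intro sum.cong refl) (simp add: funk_hecke[OF \<xi>[OF that(1)] \<xi>[OF that(2)] cont] w_def b_def)
      finally show ?thesis .
    qed
    have "(\<Sum>i<N. \<Sum>j<N. c i * c j * T m i j)
        = (\<Sum>i<N. \<Sum>j<N. \<Sum>n\<le>m. w n * (c i * c j * (b n i j * poly (gegenbauer n e) (sphere_inner d (\<xi> i) (\<xi> j)))))"
      by (intro sum.cong refl) (simp add: Tij sum_distrib_left mult_ac)
    also have "\<dots> = (\<Sum>i<N. \<Sum>n\<le>m. \<Sum>j<N. w n * (c i * c j * (b n i j * poly (gegenbauer n e) (sphere_inner d (\<xi> i) (\<xi> j)))))"
      by (intro sum.cong refl sum.swap)
    also have "\<dots> = (\<Sum>n\<le>m. \<Sum>i<N. \<Sum>j<N. w n * (c i * c j * (b n i j * poly (gegenbauer n e) (sphere_inner d (\<xi> i) (\<xi> j)))))"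
      by (rule sum.swap)
    also have "\<dots> = (\<Sum>n\<le>m. w n * (\<Sum>i<N. \<Sum>j<N. c i * c j * (b n i j * poly (gegenbauer n e) (sphere_inner d (\<xi> i) (\<xi> j)))))"
      by (simp only: sum_distrib_left)
    also have "0 \<le> \<dots>"
      unfolding d_def b_def by (intro sum_nonneg mult_nonneg_nonneg w gegenbauer_schur_product \<xi> coeff)
    finally have "0 \<le> (\<Sum>i<N. \<Sum>j<N. c i * c j * T m i j) / A m"
      unfolding A_def by (intro divide_nonneg_pos one_plus_power_mean_pos)
    then show ?thesis by (simp add: sum_divide_distrib)
  qed
  then have "0 \<le> (\<Sum>i<N. \<Sum>j<N. c i * c j * G i j (sphere_inner d (\<xi> i) (\<xi> j)))"
    by (intro LIMSEQ_le_const[OF lim]) auto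
  then show ?thesis by (simp add: d_def)
qed

section \<open>Complex and real positive definiteness\<close>

text \<open>
  The weights \<open>1\<close> and \<open>\<i>\<close> on the points \<open>x\<close> and \<open>y\<close> produce the imaginary part \<open>K y x - K x y\<close>. This is
  what complex weights give beyond real ones.
\<close>

lemma positive_definite_kernel_symmetric:
  assumes pd: "positive_definite_kernel X K" and xy: "x \<in> X" "y \<in> X"
  shows "K x y = K y x"
proof -
  define p where "p i = (if i = 0 then x else y)" for i :: nat
  define c where "c i = (if i = 0 then 1 else \<i>)" for i :: nat
  have "\<forall>i<2. p i \<in> X" using xy by (simp add: p_def)
  then have "(\<Sum>i<2. \<Sum>j<2. c i * cnj (c j) * complex_of_real (K (p i) (p j))) \<in> \<real>\<^sub>\<ge>\<^sub>0"
    using pd unfolding positive_definite_kernel_def by blast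
  then have "Im (\<Sum>i<2. \<Sum>j<2. c i * cnj (c j) * complex_of_real (K (p i) (p j))) = 0"
    by (simp add: complex_nonneg_Reals_iff)
  then show ?thesis by (simp add: numeral_2_eq_2 p_def c_def)
qed

lemma positive_definite_kernel_finite_sum:
  fixes c :: "'i \<Rightarrow> real"
  assumes pd: "positive_definite_kernel X K" and I: "finite I" "\<And>i. i \<in> I \<Longrightarrow> p i \<in> X"
  shows "0 \<le> (\<Sum>i\<in>I. \<Sum>j\<in>I. c i * c j * K (p i) (p j))"
proof -
  obtain h where h: "bij_betw h {..<card I} I"
    using ex_bij_betw_nat_finite[OF I(1)] by (auto simp: atLeast0LessThan)
  have "\<forall>i<card I. p (h i) \<in> X"
    using h I(2) by (auto dest: bij_betwE)
  then have "(\<Sum>i<card I. \<Sum>j<card I. complex_of_real (c (h i)) * cnj (complex_of_real (c (h j))) * complex_of_real (K (p (h i)) (p (h j)))) \<in> \<real>\<^sub>\<ge>\<^sub>0"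
    using pd[unfolded positive_definite_kernel_def, rule_format, of "card I" "\<lambda>i. p (h i)" "\<lambda>i. complex_of_real (c (h i))"]
    by simp
  also have "(\<Sum>i<card I. \<Sum>j<card I. complex_of_real (c (h i)) * cnj (complex_of_real (c (h j))) * complex_of_real (K (p (h i)) (p (h j))))
      = complex_of_real (\<Sum>i<card I. \<Sum>j<card I. c (h i) * c (h j) * K (p (h i)) (p (h j)))"
    by simp
  finally have "0 \<le> (\<Sum>i<card I. \<Sum>j<card I. c (h i) * c (h j) * K (p (h i)) (p (h j)))"
    by (simp only: nonneg_Reals_of_real_iff)
  also have "\<dots> = (\<Sum>i<card I. \<Sum>j\<in>I. c (h i) * c j * K (p (h i)) (p j))"
    by (intro sum.cong refl sum.reindex_bij_betw[OF h])
  also have "\<dots> = (\<Sum>i\<in>I. \<Sum>j\<in>I. c i * c j * K (p i) (p j))"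
    by (rule sum.reindex_bij_betw[OF h])
  finally show ?thesis .
qed

lemma positive_definite_kernelI:
  assumes sym: "\<And>x y. x \<in> X \<Longrightarrow> y \<in> X \<Longrightarrow> K x y = K y x"
    and real: "\<And>n p (c :: nat \<Rightarrow> real). (\<And>i. i < n \<Longrightarrow> p i \<in> X) \<Longrightarrow>
      0 \<le> (\<Sum>i<n. \<Sum>j<n. c i * c j * K (p i) (p j))"
  shows "positive_definite_kernel X K"
  unfolding positive_definite_kernel_def
proof (intro allI impI)
  fix n and p :: "nat \<Rightarrow> 'a" and c :: "nat \<Rightarrow> complex"
  assume p: "\<forall>i<n. p i \<in> X"
  let ?S = "\<Sum>i<n. \<Sum>j<n. c i * cnj (c j) * complex_of_real (K (p i) (p j))"
  have "Re ?S = (\<Sum>i<n. \<Sum>j<n. Re (c i) * Re (c j) * K (p i) (p j)) + (\<Sum>i<n. \<Sum>j<n. Im (c i) * Im (c j) * K (p i) (p j))"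
    by (simp add: algebra_simps sum.distrib)
  then have "0 \<le> Re ?S"
    using real[of n p "\<lambda>i. Re (c i)"] real[of n p "\<lambda>i. Im (c i)"] p by simp
  moreover have "Im ?S = 0"
  proof -
    let ?A = "\<Sum>i<n. \<Sum>j<n. Im (c i) * Re (c j) * K (p i) (p j)"
    let ?B = "\<Sum>i<n. \<Sum>j<n. Re (c i) * Im (c j) * K (p i) (p j)"
    have "Im ?S = ?A - ?B"
      by (simp add: algebra_simps sum_subtractf)
    also have "?B = (\<Sum>j<n. \<Sum>i<n. Re (c i) * Im (c j) * K (p i) (p j))"
      by (rule sum.swap)
    also have "\<dots> = ?A"
      using p by (intro sum.cong refl) (simp add: sym mult.commute)
    finally show ?thesis by simp
  qed
  ultimately show "?S \<in> \<real>\<^sub>\<ge>\<^sub>0" by (simp add: complex_nonneg_Reals_iff)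
qed

section \<open>The derivative of a positive definite function\<close>

text \<open>
  Evenness of \<open>f\<close> in time is only visible at values \<open>x\<close> that are inner products of points of the sphere;
  from dimension 1 on these fill all of \<open>[-1, 1]\<close>.
\<close>

lemma sphere_inner_surj:
  assumes "x \<in> {-1..1}"
  shows "\<exists>\<xi>\<in>unit_sphere (Suc e). \<exists>\<eta>\<in>unit_sphere (Suc e). sphere_inner (Suc e) \<xi> \<eta> = x"
proof -
  define \<xi> :: "nat \<Rightarrow> real" where "\<xi> i = (if i = 0 then 1 else 0)" for i
  define \<eta> where "\<eta> i = (if i = 0 then x else if i = 1 then sqrt (1 - x\<^sup>2) else 0)" for i :: nat
  have sum2: "(\<Sum>i\<le>Suc e. g i) = g 0 + g 1" if "\<And>i. i > 1 \<Longrightarrow> g i = 0" for g :: "nat \<Rightarrow> real"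
  proof -
    have "(\<Sum>i\<le>Suc e. g i) = (\<Sum>i\<in>{0, 1}. g i)"
      by (rule sum.mono_neutral_right) (auto intro: that)
    then show ?thesis by simp
  qed
  have "x\<^sup>2 \<le> 1" using assms by (simp add: abs_square_le_1 abs_le_iff)
  then have "sqrt (1 - x\<^sup>2) * sqrt (1 - x\<^sup>2) = 1 - x\<^sup>2" by simp
  then have "(\<Sum>i\<le>Suc e. \<eta> i * \<eta> i) = 1"
    by (subst sum2) (simp_all add: \<eta>_def power2_eq_square)
  then have "\<eta> \<in> unit_sphere (Suc e)" unfolding mem_unit_sphere by (simp add: \<eta>_def)
  moreover have "\<xi> \<in> unit_sphere (Suc e)"
    unfolding mem_unit_sphere by (subst sum2) (simp_all add: \<xi>_def)
  moreover have "sphere_inner (Suc e) \<xi> \<eta> = x"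
    unfolding sphere_inner_def by (subst sum2) (simp_all add: \<xi>_def \<eta>_def)
  ultimately show ?thesis by blast
qed

text \<open>
  Composing with the retraction onto \<open>[-1, 1]\<close> turns functions that are continuous on that interval into
  continuous functions on the line with the same values there.
\<close>

definition clip :: "real \<Rightarrow> real"
  where "clip x = max (-1) (min 1 x)"

lemma clip_in_Icc: "clip x \<in> {-1..1}"
  by (simp add: clip_def)

lemma clip_eq: "x \<in> {-1..1} \<Longrightarrow> clip x = x"
  by (simp add: clip_def)

lemma continuous_on_clip:
  assumes "continuous_on ({-1..1} \<times> UNIV) h"
  shows "continuous_on UNIV (\<lambda>x. h (clip x, t))"
  by (rule continuous_on_compose2[OF assms])
     (use clip_in_Icc in \<open>auto simp: clip_def intro!: continuous_intros\<close>)

lemma pd_sphere_line_even: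
  assumes "f \<in> pd_sphere_line d" "\<xi> \<in> unit_sphere d" "\<eta> \<in> unit_sphere d"
  shows "f (sphere_inner d \<xi> \<eta>, t) = f (sphere_inner d \<xi> \<eta>, - t)"
proof -
  have "positive_definite_kernel (unit_sphere d \<times> (UNIV :: real set))
      (\<lambda>(\<xi>, s) (\<eta>, t). f (cos (geodesic_dist d \<xi> \<eta>), s - t))"
    using assms(1) by (simp add: pd_sphere_line_def)
  from positive_definite_kernel_symmetric[OF this, of "(\<xi>, t)" "(\<eta>, 0)"]
  show ?thesis using assms sphere_inner_commute[of d \<xi> \<eta>] by (simp add: cos_geodesic_dist)
qed

text \<open>
  Freezing the times and a weight vector over them leaves a scalar positive definite function: points
  \<open>u k\<close> with weights \<open>b k\<close> are tested by the pairs \<open>(u k, t i)\<close> with weights \<open>b k * a i\<close>.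
\<close>

lemma pd_sphere_line_quadratic_form:
  fixes a :: "nat \<Rightarrow> real"
  assumes f: "f \<in> pd_sphere_line d"
  shows "zonal_positive_definite d (\<lambda>x. \<Sum>i<N. \<Sum>j<N. a i * a j * f (clip x, t i - t j))"
  unfolding zonal_positive_definite_def
proof (intro allI impI)
  fix M and u :: "nat \<Rightarrow> nat \<Rightarrow> real" and b :: "nat \<Rightarrow> real"
  assume u: "\<forall>k<M. u k \<in> unit_sphere d"
  define I where "I = {..<M} \<times> {..<N}"
  have pd: "positive_definite_kernel (unit_sphere d \<times> (UNIV :: real set))
      (\<lambda>(\<xi>, s) (\<eta>, t). f (cos (geodesic_dist d \<xi> \<eta>), s - t))"
    using f by (simp add: pd_sphere_line_def)
  have "0 \<le> (\<Sum>r\<in>I. \<Sum>s\<in>I. (b (fst r) * a (snd r)) * (b (fst s) * a (snd s)) *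
      f (cos (geodesic_dist d (u (fst r)) (u (fst s))), t (snd r) - t (snd s)))"
    using positive_definite_kernel_finite_sum[OF pd, of I "\<lambda>r. (u (fst r), t (snd r))" "\<lambda>r. b (fst r) * a (snd r)"] u
    by (auto simp: I_def)
  also have "\<dots> = (\<Sum>r\<in>I. \<Sum>s\<in>I. (b (fst r) * a (snd r)) * (b (fst s) * a (snd s)) *
      f (clip (sphere_inner d (u (fst r)) (u (fst s))), t (snd r) - t (snd s)))"
    using u by (intro sum.cong refl) (auto simp: I_def cos_geodesic_dist clip_eq[OF sphere_inner_in_Icc])
  also have "\<dots> = (\<Sum>k<M. \<Sum>i<N. \<Sum>l<M. \<Sum>j<N. (b k * a i) * (b l * a j) *
      f (clip (sphere_inner d (u k) (u l)), t i - t j))"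
    unfolding I_def by (simp add: sum.cartesian_product')
  also have "\<dots> = (\<Sum>k<M. \<Sum>l<M. \<Sum>i<N. \<Sum>j<N. (b k * a i) * (b l * a j) *
      f (clip (sphere_inner d (u k) (u l)), t i - t j))"
    by (intro sum.cong refl sum.swap)
  also have "\<dots> = (\<Sum>k<M. \<Sum>l<M. b k * b l * (\<Sum>i<N. \<Sum>j<N. a i * a j * f (clip (sphere_inner d (u k) (u l)), t i - t j)))"
    by (intro sum.cong refl) (simp add: sum_distrib_left mult_ac)
  finally show "0 \<le> (\<Sum>k<M. \<Sum>l<M. b k * b l * (\<Sum>i<N. \<Sum>j<N. a i * a j * f (clip (sphere_inner d (u k) (u l)), t i - t j)))" .
qed

text \<open>
  The coefficient of the derivative of degree \<open>n\<close> on the sphere of dimension \<open>e + 3\<close> is a positive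
  multiple of the coefficient of \<open>f\<close> of degree \<open>n + 1\<close> on the sphere of dimension \<open>e + 1\<close>.
\<close>

lemma partial_fst_coefficient_nonneg:
  fixes a :: "nat \<Rightarrow> real"
  assumes df: "continuously_differentiable_fst f" and f: "f \<in> pd_sphere_line (Suc e)"
  shows "0 \<le> (\<Sum>i<N. \<Sum>j<N. a i * a j *
    zonal_mean (e + 2) (\<lambda>x. partial_fst f (clip x, t i - t j) * poly (gegenbauer n (e + 2)) x))"
proof -
  define \<kappa> where "\<kappa> = integral {0..pi} (\<lambda>\<theta>::real. sin \<theta> ^ (e + 2)) / integral {0..pi} (\<lambda>\<theta>. sin \<theta> ^ e)"
  have \<kappa>: "\<kappa> > 0" unfolding \<kappa>_def by (intro divide_pos_pos sin_power_integral_pos)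
  have contf: "continuous_on ({-1..1} \<times> UNIV) f" using f by (simp add: pd_sphere_line_def)
  have contf': "continuous_on ({-1..1} \<times> UNIV) (partial_fst f)"
    using df by (simp add: continuously_differentiable_fst_def)
  let ?q = "gegenbauer (Suc n) e" and ?q' = "gegenbauer n (e + 2)"
  have shift: "zonal_mean e (\<lambda>x. f (clip x, s) * poly ?q x)
      = \<kappa> * zonal_mean (e + 2) (\<lambda>x. partial_fst f (clip x, s) * poly ?q' x)" for s
  proof -
    have c: "continuous_on {-1..1} (\<lambda>x. partial_fst f (x, s))"
      by (rule continuous_on_compose2[OF contf']) (auto intro!: continuous_intros)
    have "zonal_mean e (\<lambda>x. f (clip x, s) * poly ?q x) = zonal_mean e (\<lambda>x. f (x, s) * poly ?q x)"
      by (rule zonal_mean_cong) (simp add: clip_eq)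
    also have "\<dots> = zonal_mean e (\<lambda>x. (1 - x\<^sup>2) * (partial_fst f (x, s) * poly ?q' x))"
      by (rule gegenbauer_stein[OF has_real_derivative_partial_fst[OF df] c])
    also have "\<dots> = \<kappa> * zonal_mean (e + 2) (\<lambda>x. partial_fst f (x, s) * poly ?q' x)"
      unfolding \<kappa>_def by (rule zonal_mean_weight_shift)
    also have "zonal_mean (e + 2) (\<lambda>x. partial_fst f (x, s) * poly ?q' x)
        = zonal_mean (e + 2) (\<lambda>x. partial_fst f (clip x, s) * poly ?q' x)"
      by (rule zonal_mean_cong) (simp add: clip_eq)
    finally show ?thesis .
  qed
  let ?F = "\<lambda>x. \<Sum>i<N. \<Sum>j<N. a i * a j * f (clip x, t i - t j)"
  have cF: "continuous_on S (\<lambda>x. f (clip x, s))" for S s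
    using continuous_on_clip[OF contf] continuous_on_subset by blast
  have "0 \<le> zonal_mean e (\<lambda>x. ?F x * poly ?q x)"
    by (intro gegenbauer_coefficient_nonneg continuous_on_sum continuous_on_mult continuous_on_const cF pd_sphere_line_quadratic_form f)
  also have "\<dots> = zonal_mean e (\<lambda>x. \<Sum>i<N. \<Sum>j<N. a i * a j * (f (clip x, t i - t j) * poly ?q x))"
    by (rule zonal_mean_cong) (simp only: sum_distrib_right mult.assoc)
  also have "\<dots> = (\<Sum>i<N. zonal_mean e (\<lambda>x. \<Sum>j<N. a i * a j * (f (clip x, t i - t j) * poly ?q x)))"
    by (intro zonal_mean_sum finite_lessThan continuous_intros cF)
  also have "\<dots> = (\<Sum>i<N. \<Sum>j<N. zonal_mean e (\<lambda>x. a i * a j * (f (clip x, t i - t j) * poly ?q x)))"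
    by (intro sum.cong refl zonal_mean_sum finite_lessThan continuous_intros cF)
  also have "\<dots> = (\<Sum>i<N. \<Sum>j<N. \<kappa> * (a i * a j * zonal_mean (e + 2) (\<lambda>x. partial_fst f (clip x, t i - t j) * poly ?q' x)))"
    by (simp only: zonal_mean_cmult shift) (simp only: mult_ac)
  also have "\<dots> = \<kappa> * (\<Sum>i<N. \<Sum>j<N. a i * a j * zonal_mean (e + 2) (\<lambda>x. partial_fst f (clip x, t i - t j) * poly ?q' x))"
    by (simp only: sum_distrib_left)
  finally show ?thesis using \<kappa> by (simp only: zero_le_mult_iff) linarith
qed

lemma partial_fst_even:
  assumes "\<And>u. u \<in> {-1..1} \<Longrightarrow> f (u, t) = f (u, - t)" and x: "x \<in> {-1..1}"
  shows "partial_fst f (x, t) = partial_fst f (x, - t)"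
proof -
  have "((\<lambda>u. f (u, t)) has_vector_derivative D) (at x within {-1..1})
      \<longleftrightarrow> ((\<lambda>u. f (u, - t)) has_vector_derivative D) (at x within {-1..1})" for D
    using assms by (auto elim!: has_vector_derivative_transform[OF x, rotated])
  then show ?thesis by (simp add: partial_fst_def vector_derivative_def)
qed

theorem theorem2p2:
  fixes d :: nat and f :: "real \<times> real \<Rightarrow> real"
  assumes "d \<ge> 1"
    and "continuously_differentiable_fst f"
    and "f \<in> pd_sphere_line d"
  shows "partial_fst f \<in> pd_sphere_line (d + 2)"
proof -
  obtain e where d: "d = Suc e" using assms(1) by (cases d) auto
  have d2: "d + 2 = Suc (e + 2)" by (simp add: d)
  have cont: "continuous_on ({-1..1} \<times> UNIV) (partial_fst f)"
    using assms(2) by (simp add: continuously_differentiable_fst_def)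
  have even: "f (u, t) = f (u, - t)" if "u \<in> {-1..1}" for u t
    using sphere_inner_surj[OF that, of e] pd_sphere_line_even[OF assms(3)] d by metis
  have "positive_definite_kernel (unit_sphere (d + 2) \<times> (UNIV :: real set))
      (\<lambda>(\<xi>, s) (\<eta>, t). partial_fst f (cos (geodesic_dist (d + 2) \<xi> \<eta>), s - t))"
  proof (rule positive_definite_kernelI)
    fix x y :: "(nat \<Rightarrow> real) \<times> real"
    assume "x \<in> unit_sphere (d + 2) \<times> UNIV" "y \<in> unit_sphere (d + 2) \<times> UNIV"
    then obtain \<xi> s \<eta> t where xy: "x = (\<xi>, s)" "y = (\<eta>, t)"
      and s: "\<xi> \<in> unit_sphere (d + 2)" "\<eta> \<in> unit_sphere (d + 2)" by blast
    have "partial_fst f (sphere_inner (d + 2) \<xi> \<eta>, s - t) = partial_fst f (sphere_inner (d + 2) \<xi> \<eta>, - (s - t))"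
      by (rule partial_fst_even[OF even sphere_inner_in_Icc[OF s]])
    then show "(case x of (\<xi>, s) \<Rightarrow> \<lambda>(\<eta>, t). partial_fst f (cos (geodesic_dist (d + 2) \<xi> \<eta>), s - t)) y
       = (case y of (\<xi>, s) \<Rightarrow> \<lambda>(\<eta>, t). partial_fst f (cos (geodesic_dist (d + 2) \<xi> \<eta>), s - t)) x"
      by (simp only: xy prod.case cos_geodesic_dist[OF s] cos_geodesic_dist[OF s(2) s(1)]
          minus_diff_eq sphere_inner_commute[of "d + 2" \<eta> \<xi>])
  next
    fix n and p :: "nat \<Rightarrow> (nat \<Rightarrow> real) \<times> real" and c :: "nat \<Rightarrow> real"
    assume p: "\<And>i. i < n \<Longrightarrow> p i \<in> unit_sphere (d + 2) \<times> UNIV"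
    then have s: "fst (p i) \<in> unit_sphere (Suc (e + 2))" if "i < n" for i
      using that by (auto simp: mem_Times_iff d)
    have "0 \<le> (\<Sum>i<n. \<Sum>j<n. c i * c j *
        partial_fst f (clip (sphere_inner (Suc (e + 2)) (fst (p i)) (fst (p j))), snd (p i) - snd (p j)))"
      by (rule zonal_synthesis)
         (use s partial_fst_coefficient_nonneg[OF assms(2) assms(3)[unfolded d]] continuous_on_clip[OF cont] in auto)
    also have "\<dots> = (\<Sum>i<n. \<Sum>j<n. c i * c j *
        (case p i of (\<xi>, s) \<Rightarrow> \<lambda>(\<eta>, t). partial_fst f (cos (geodesic_dist (d + 2) \<xi> \<eta>), s - t)) (p j))"
    proof (intro sum.cong refl arg_cong2[where f = "(*)"])
      fix i j assume "i \<in> {..<n}" "j \<in> {..<n}"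
      then have ij: "fst (p i) \<in> unit_sphere (Suc (e + 2))" "fst (p j) \<in> unit_sphere (Suc (e + 2))"
        using s by auto
      show "partial_fst f (clip (sphere_inner (Suc (e + 2)) (fst (p i)) (fst (p j))), snd (p i) - snd (p j))
        = (case p i of (\<xi>, s) \<Rightarrow> \<lambda>(\<eta>, t). partial_fst f (cos (geodesic_dist (d + 2) \<xi> \<eta>), s - t)) (p j)"
        by (simp only: case_prod_beta d2 cos_geodesic_dist[OF ij] clip_eq[OF sphere_inner_in_Icc[OF ij]])
    qed
    finally show "0 \<le> (\<Sum>i<n. \<Sum>j<n. c i * c j *
        (case p i of (\<xi>, s) \<Rightarrow> \<lambda>(\<eta>, t). partial_fst f (cos (geodesic_dist (d + 2) \<xi> \<eta>), s - t)) (p j))" .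
  qed
  then show ?thesis using cont by (simp add: pd_sphere_line_def)
qed

end
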